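(* Let $X_1,\ldots,X_n\overset{iid}{\sim}N_p(0,\Omega_{0,n}^{-1})$ with $p=p_n\to\infty$ and $p\le\exp(cn)$ for some constant $c>0$. Assume that the true precision matrix satisfies $\Omega_{0,n}\in\mathcal U(\epsilon_0,\gamma)$ for a given $\epsilon_0>0$ and a decreasing function $\gamma$. (i) If there exists a constant $k_0>0$ such that $\gamma(k)=0$ for all $k\ge k_0$, then $$\inf_{\widehat\Omega_n}\ \sup_{\Omega_{0,n}\in\mathcal U(\epsilon_0,\gamma)}\mathbb E_{0n}\|\widehat\Omega_n-\Omega_{0,n}\|\ \gtrsim\ \left(\frac{\log p}{n}\right)^{1/2}.$$ (ii) If $\gamma(k)=Ce^{-\beta k}$ for some constants $\beta>0$ and $C>0$, then $$\inf_{\widehat\Omega_n}\ \sup_{\Omega_{0,n}\in\mathcal U(\epsilon_0,\gamma)}\mathbb E_{0n}\|\widehat\Omega_n-\Omega_{0,n}\|\ \gtrsim\ \min\left\{\left(\frac{\log(n\vee p)}{n}\right)^{1/2},\ \left(\frac pn\right)^{1/2}\right\}.$$ (iii) If $\gamma(k)=Ck^{-\alpha}$ for some constants $\alpha>0$ and $C>0$, then $$\inf_{\widehat\Omega_n}\ \sup_{\Omega_{0,n}\in\mathcal U(\epsilon_0,\gamma)}\mathbb E_{0n}\|\widehat\Omega_n-\Omega_{0,n}\|\ \gtrsim\ \min\left\{\left(\frac{\log p}{n}\right)^{1/2}+n^{-\alpha/(2\alpha+1)},\ \left(\frac pn\right)^{1/2}\right\}.$$ Here the infimum is over all estimators $\widehat\Omega_n$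 (measurable functions of $X_1,\ldots,X_n$).
   Context: Every $p\times p$ positive definite matrix $\Omega$ has a unique modified Cholesky decomposition (MCD) $\Omega=(I_p-A)^TD^{-1}(I_p-A)$, with $A=(a_{ij})$ lower triangular with zero diagonal and $D$ diagonal with positive diagonal entries. For a matrix $A=(a_{ij})$, $B_k(A)=(a_{ij}I(|i-j|\le k))_{i,j}$, $\|A\|_\infty=\max_i\sum_j|a_{ij}|$, and $\|A\|$ is the spectral norm ($\ell_2\to\ell_2$ operator norm). For a constant $\epsilon_0>0$ and a decreasing function $\gamma(k)\to0$ as $k\to\infty$ (on positive integers), $\mathcal U(\epsilon_0,\gamma)=\mathcal U_p(\epsilon_0,\gamma)$ is the set of $p\times p$ positive definite $\Omega$ with MCD $\Omega=(I_p-A)^TD^{-1}(I_p-A)$ such that $\epsilon_0\le\lambda_{\min}(\Omega)\le\lambda_{\max}(\Omega)\le\epsilon_0^{-1}$ and $\|A-B_k(A)\|_\infty\le\gamma(k)$ for all $0<k\le p-1$. $\mathbb E_{0n}$ is expectation under $X_1,\ldots,X_n\overset{iid}{\sim}N_p(0,\Omega_{0,n}^{-1})$. $a\vee b=\max(a,b)$. For positive sequences, $a_n\lesssim b_n$ (equivalently $b_n\gtrsim a_n$) means there is a constant $C>0$ not depending on $n$ with $a_n\le Cb_n$ for all sufficiently large $n$. Asymptotics are as $n\to\infty$ with $p=p_n$ increasing to $\infty$.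
   Formalization: The condition ε₀ < 1 is added: for ε₀ = 1 the class U(ε₀,γ) is just {I_p}, so the constant estimator I_p has risk 0 and the lower bounds fail; for ε₀ > 1 the class is empty. *)

theory Defs
  imports "HOL-Probability.Probability" "Jordan_Normal_Form.Spectral_Radius"
begin

text \<open>
  The dimension \<open>p = p\<^sub>n\<close> varies with \<open>n\<close>, so matrices and vectors are those of
  Jordan_Normal_Form, with explicit carriers. Indices run over \<open>{0..<p}\<close>. A sample
  \<open>(X\<^sub>1,\<dots>,X\<^sub>n)\<close> is a function \<open>x\<close> with \<open>x i j\<close> the \<open>j\<close>-th coordinate of the \<open>i\<close>-th observation.
\<close>

definition inv_mat :: "real mat \<Rightarrow> real mat" where
  \<comment> \<open>meaningful for invertible matrices only\<close>
  "inv_mat M = the (mat_inverse M)"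

definition pos_def :: "nat \<Rightarrow> real mat \<Rightarrow> bool" where
  "pos_def p M \<longleftrightarrow> M \<in> carrier_mat p p \<and> transpose_mat M = M \<and>
     (\<forall>v \<in> carrier_vec p. v \<noteq> 0\<^sub>v p \<longrightarrow> scalar_prod v (M *\<^sub>v v) > 0)"

definition is_mcd :: "nat \<Rightarrow> real mat \<Rightarrow> real mat \<Rightarrow> real mat \<Rightarrow> bool" where
  "is_mcd p \<Omega> A D \<longleftrightarrow>
     A \<in> carrier_mat p p \<and> (\<forall>i<p. \<forall>j<p. i \<le> j \<longrightarrow> A $$ (i, j) = 0) \<and>
     D \<in> carrier_mat p p \<and> diagonal_mat D \<and> (\<forall>i<p. D $$ (i, i) > 0) \<and>
     \<Omega> = transpose_mat (1\<^sub>m p - A) * inv_mat D * (1\<^sub>m p - A)"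

definition banding :: "nat \<Rightarrow> real mat \<Rightarrow> real mat" where
  "banding k A = Matrix.mat (dim_row A) (dim_col A)
     (\<lambda>(i, j). if \<bar>int i - int j\<bar> \<le> int k then A $$ (i, j) else 0)"

definition inf_norm_mat :: "real mat \<Rightarrow> real" where
  "inf_norm_mat A = Max ((\<lambda>i. \<Sum>j<dim_col A. \<bar>A $$ (i, j)\<bar>) ` {..<dim_row A})"

definition l2_norm_vec :: "real vec \<Rightarrow> real" where
  "l2_norm_vec v = sqrt (scalar_prod v v)"

definition spectral_norm :: "real mat \<Rightarrow> real" where
  "spectral_norm A = Sup {l2_norm_vec (A *\<^sub>v v) | v. v \<in> carrier_vec (dim_col A) \<and> l2_norm_vec v \<le> 1}"

definition lambda_min :: "real mat \<Rightarrow> real" where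
  "lambda_min M = Min (spectrum M)"

definition lambda_max :: "real mat \<Rightarrow> real" where
  "lambda_max M = Max (spectrum M)"

definition precision_class :: "nat \<Rightarrow> real \<Rightarrow> (nat \<Rightarrow> real) \<Rightarrow> real mat set" where
  "precision_class p \<epsilon>\<^sub>0 \<gamma> = {\<Omega>. pos_def p \<Omega> \<and>
     \<epsilon>\<^sub>0 \<le> lambda_min \<Omega> \<and> lambda_min \<Omega> \<le> lambda_max \<Omega> \<and> lambda_max \<Omega> \<le> inverse \<epsilon>\<^sub>0 \<and>
     (\<exists>A D. is_mcd p \<Omega> A D \<and>
        (\<forall>k. 0 < k \<and> k \<le> p - 1 \<longrightarrow> inf_norm_mat (A - banding k A) \<le> \<gamma> k))}"

definition normal_vec_density :: "nat \<Rightarrow> real mat \<Rightarrow> (nat \<Rightarrow> real) \<Rightarrow> real" where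
  "normal_vec_density p \<Sigma> x =
     exp (- scalar_prod (Matrix.vec p x) (inv_mat \<Sigma> *\<^sub>v Matrix.vec p x) / 2) /
     sqrt ((2 * pi) ^ p * Determinant.det \<Sigma>)"

definition normal_vec_measure :: "nat \<Rightarrow> real mat \<Rightarrow> (nat \<Rightarrow> real) measure" where
  \<comment> \<open>\<open>N\<^sub>p(0, \<Sigma>)\<close>, for a positive definite covariance matrix \<open>\<Sigma>\<close>\<close>
  "normal_vec_measure p \<Sigma> =
     density (Pi\<^sub>M {..<p} (\<lambda>_. lborel)) (\<lambda>x. ennreal (normal_vec_density p \<Sigma> x))"

definition sample_law :: "nat \<Rightarrow> nat \<Rightarrow> real mat \<Rightarrow> (nat \<Rightarrow> nat \<Rightarrow> real) measure" where
  "sample_law n p \<Omega> = Pi\<^sub>M {..<n} (\<lambda>_. normal_vec_measure p (inv_mat \<Omega>))"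

definition sample_space :: "nat \<Rightarrow> nat \<Rightarrow> (nat \<Rightarrow> nat \<Rightarrow> real) measure" where
  "sample_space n p = Pi\<^sub>M {..<n} (\<lambda>_. Pi\<^sub>M {..<p} (\<lambda>_. borel))"

text \<open>Measurability of a matrix-valued map is measurability of all its entries.\<close>

definition estimators :: "nat \<Rightarrow> nat \<Rightarrow> ((nat \<Rightarrow> nat \<Rightarrow> real) \<Rightarrow> real mat) set" where
  "estimators n p = {T. (\<forall>x \<in> space (sample_space n p). T x \<in> carrier_mat p p) \<and>
     (\<forall>i<p. \<forall>j<p. (\<lambda>x. T x $$ (i, j)) \<in> borel_measurable (sample_space n p))}"

text \<open>Risks take values in \<open>[0, \<infinity>]\<close>, so estimators with non-integrable loss have risk \<open>\<infinity>\<close>.\<close>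

definition risk :: "nat \<Rightarrow> nat \<Rightarrow> ((nat \<Rightarrow> nat \<Rightarrow> real) \<Rightarrow> real mat) \<Rightarrow> real mat \<Rightarrow> ennreal" where
  "risk n p T \<Omega> = (\<integral>\<^sup>+ x. ennreal (spectral_norm (T x - \<Omega>)) \<partial>sample_law n p \<Omega>)"

definition minimax_risk :: "nat \<Rightarrow> nat \<Rightarrow> real \<Rightarrow> (nat \<Rightarrow> real) \<Rightarrow> ennreal" where
  "minimax_risk n p \<epsilon>\<^sub>0 \<gamma> = (INF T \<in> estimators n p. SUP \<Omega> \<in> precision_class p \<epsilon>\<^sub>0 \<gamma>. risk n p T \<Omega>)"

definition asymp_gtrsim :: "(nat \<Rightarrow> ennreal) \<Rightarrow> (nat \<Rightarrow> real) \<Rightarrow> bool" (infix \<open>\<greatersim>\<close> 50) where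
  "b \<greatersim> a \<longleftrightarrow> (\<exists>C::real. C > 0 \<and> (\<forall>\<^sub>F n in sequentially. ennreal (a n) \<le> ennreal C * b n))"

end

theory Submission
  imports Defs
begin

text \<open>
  Both lower bounds come from Gaussian models in which every coordinate is standard normal noise plus a
  small multiple \<open>\<delta>\<close> of at most one earlier coordinate, its parent. The matrix \<open>A\<close> of the modified Cholesky
  decomposition then has at most one nonzero entry per row, \<open>D\<close> is the identity, and the law is described by a
  forest. Densities of such models are products of one-dimensional normal densities, and a forest density
  times the likelihood ratios of two additional edges is again a multiple of a forest density. Hence
  every integral that is needed reduces to \<open>nn_integral_forest_density\<close>: a forest density has integral 1.

  Deciding whether one edge of weight \<open>\<delta>\<close> is present is governed by chi-square affinities. By
  \<open>forest_overlap_distinct\<close> and \<open>forest_overlap_same\<close>, they are 1 for two distinct edges and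
  \<open>1 / sqrt (1 - 2 * \<delta>\<^sup>2)\<close> per observation for the same edge twice, at most \<open>exp (2 * n * \<delta>\<^sup>2)\<close> for the sample.
  Le Cam's method against a mixture (\<open>forest_edge_detection\<close>) turns this into a lower bound on losses and is used twice.

  \<^item> \<open>minimax_risk_ge_single_edge\<close>: the edge is hidden among the \<open>p - 1\<close> pairs of neighbouring coordinates. It stays
    undetected as long as \<open>exp (2 * n * \<delta>\<^sup>2) \<le> p\<close>, which gives the rate \<open>sqrt (ln p / n)\<close> for every nonnegative \<open>\<gamma>\<close>.
  \<^item> \<open>minimax_risk_ge_star\<close>: each of \<open>k\<close> coordinates may or may not be a child of the first one, with weight of
    order \<open>1 / sqrt n\<close>. No single edge is detectable, so a constant share of the column of \<open>k\<close> entries is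
    misjudged, and the spectral norm of the error is at least of order \<open>sqrt (k / n)\<close>. The tail constraint sees one
    edge per row, so all it asks is \<open>\<delta> \<le> \<gamma> i\<close> for \<open>0 < i < k\<close>.

  For exponentially decaying \<open>\<gamma>\<close> the star may have \<open>k\<close> of order \<open>ln n\<close>, for \<open>\<gamma> k = C * k powr (- \<alpha>)\<close> it may have
  \<open>k\<close> of order \<open>n powr (1 / (2 * \<alpha> + 1))\<close>, and in each case \<open>k\<close> is capped by the dimension, which produces the
  terms \<open>sqrt (p / n)\<close>.
\<close>

section \<open>Densities of finite products\<close>

lemma density_PiM_finite:
  fixes M :: "'i \<Rightarrow> 'a measure" and f :: "'i \<Rightarrow> 'a \<Rightarrow> ennreal"
  assumes fin: "finite I"
    and sf: "\<And>i. sigma_finite_measure (M i)"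
    and sfd: "\<And>i. sigma_finite_measure (density (M i) (f i))"
    and f: "\<And>i. f i \<in> borel_measurable (M i)"
  shows "Pi\<^sub>M I (\<lambda>i. density (M i) (f i)) = density (Pi\<^sub>M I M) (\<lambda>x. \<Prod>i\<in>I. f i (x i))"
proof -
  interpret M: product_sigma_finite M using sf by (simp add: product_sigma_finite_def)
  interpret D: product_sigma_finite "\<lambda>i. density (M i) (f i)"
    using sfd by (simp add: product_sigma_finite_def)
  note f[measurable]
  have "density (Pi\<^sub>M I M) (\<lambda>x. \<Prod>i\<in>I. f i (x i)) = Pi\<^sub>M I (\<lambda>i. density (M i) (f i))"
  proof (rule D.PiM_eqI[OF fin])
    show "sets (density (Pi\<^sub>M I M) (\<lambda>x. \<Prod>i\<in>I. f i (x i))) = sets (Pi\<^sub>M I (\<lambda>i. density (M i) (f i)))"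
      by (auto intro!: sets_PiM_cong)
    fix A assume "\<And>i. i \<in> I \<Longrightarrow> A i \<in> sets (density (M i) (f i))"
    then have A: "\<And>i. i \<in> I \<Longrightarrow> A i \<in> sets (M i)" by simp
    have "emeasure (density (Pi\<^sub>M I M) (\<lambda>x. \<Prod>i\<in>I. f i (x i))) (Pi\<^sub>E I A)
        = (\<integral>\<^sup>+x. (\<Prod>i\<in>I. f i (x i)) * indicator (Pi\<^sub>E I A) x \<partial>Pi\<^sub>M I M)"
      using A fin by (subst emeasure_density) (auto intro!: sets_PiM_I_finite)
    also have "\<dots> = (\<integral>\<^sup>+x. (\<Prod>i\<in>I. f i (x i) * indicator (A i) (x i)) \<partial>Pi\<^sub>M I M)"
      using fin
      by (intro nn_integral_cong) (auto simp: indicator_def prod.distrib space_PiM PiE_iff prod_zero_iff)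
    also have "\<dots> = (\<Prod>i\<in>I. \<integral>\<^sup>+y. f i y * indicator (A i) y \<partial>M i)"
      using A fin by (intro M.product_nn_integral_prod) auto
    also have "\<dots> = (\<Prod>i\<in>I. emeasure (density (M i) (f i)) (A i))"
      using A by (intro prod.cong refl) (simp add: emeasure_density)
    finally show "emeasure (density (Pi\<^sub>M I M) (\<lambda>x. \<Prod>i\<in>I. f i (x i))) (Pi\<^sub>E I A)
        = (\<Prod>i\<in>I. emeasure (density (M i) (f i)) (A i))" .
  qed
  then show ?thesis by simp
qed

section \<open>Le Cam's method against a mixture\<close>

text \<open>
  The pointwise core of Le Cam's method. With \<open>Q = \<Sum>i\<in>I. q i\<close> the two losses together cost at least
  \<open>a * min (N * g0) Q\<close>, and \<open>min s Q \<ge> Q - Q\<^sup>2 / (4 * s)\<close> because \<open>(Q - 2 * s)\<^sup>2 \<ge> 0\<close>. The quadratic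
  correction integrates to a chi-square affinity, so no total variation distance has to be estimated.
\<close>

lemma weighted_losses_ge_total_mass:
  fixes u g0 g1 a :: real and w :: "'i \<Rightarrow> real" and q :: "'i \<Rightarrow> real"
  assumes fin: "finite I" and u: "u \<ge> 0" and a: "a \<ge> 0" and g0: "g0 > 0"
    and q: "\<And>i. i \<in> I \<Longrightarrow> q i \<ge> 0" and w: "\<And>i. i \<in> I \<Longrightarrow> w i \<ge> 0"
    and sep: "\<And>i. i \<in> I \<Longrightarrow> a \<le> u + w i"
    and N: "N > 0"
  shows "a * (\<Sum>i\<in>I. q i)
      \<le> N * (u * g0) + (\<Sum>i\<in>I. w i * q i) + a / (4 * N) * (\<Sum>i\<in>I. \<Sum>j\<in>I. q i * q j / g0)"
proof -
  define Q where "Q = (\<Sum>i\<in>I. q i)"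
  have Q: "Q \<ge> 0" using q by (auto simp: Q_def intro: sum_nonneg)
  have dbl: "(\<Sum>i\<in>I. \<Sum>j\<in>I. q i * q j / g0) = Q^2 / g0"
    by (simp add: Q_def power2_eq_square sum_product sum_divide_distrib)
  have W: "(\<Sum>i\<in>I. w i * q i) \<ge> max 0 (a - u) * Q"
    unfolding Q_def sum_distrib_left
    using q w sep by (intro sum_mono mult_right_mono) (force simp: max_def)+
  have sq: "Q \<le> N * g0 + Q^2 / (4 * N * g0)"
  proof -
    have "0 \<le> (Q - 2 * (N * g0))^2" by simp
    then have "4 * (N * g0) * Q \<le> 4 * (N * g0) * (N * g0) + Q^2" by (simp add: power2_eq_square algebra_simps)
    then show ?thesis using N g0 by (simp add: field_simps power2_eq_square)
  qed
  have nn: "Q^2 / (4 * N * g0) \<ge> 0" using N g0 by simp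
  have "a * Q \<le> N * (u * g0) + max 0 (a - u) * Q + a * (Q^2 / (4 * N * g0))"
  proof (cases "u \<le> a")
    case True
    have "u * Q \<le> u * (N * g0 + Q^2 / (4 * N * g0))" using sq u by (rule mult_left_mono)
    also have "\<dots> \<le> u * (N * g0) + a * (Q^2 / (4 * N * g0))"
      using mult_right_mono[OF True nn] by (simp add: algebra_simps)
    finally show ?thesis using True by (simp add: max_def algebra_simps)
  next
    case False
    have "a * Q \<le> a * (N * g0 + Q^2 / (4 * N * g0))" using sq a by (rule mult_left_mono)
    also have "\<dots> \<le> u * (N * g0) + a * (Q^2 / (4 * N * g0))"
      using mult_right_mono[of a u "N * g0"] False N g0 by (simp add: algebra_simps)
    finally show ?thesis using False by (simp add: max_def algebra_simps)
  qed
  also have "a * (Q^2 / (4 * N * g0)) = a / (4 * N) * (Q^2 / g0)" by simp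
  finally show ?thesis using W unfolding dbl Q_def[symmetric] by linarith
qed

text \<open>
  One null density \<open>g0\<close> is tested against the uniform mixture of the \<open>q i\<close>. If the second moment of the
  mixture's likelihood ratio is at most 2, then \<open>weighted_losses_ge_total_mass\<close> integrates to
  \<open>a * N - a * N / 2\<close>. A single alternative gives the two-point method; many alternatives
  give the logarithmic gain, since the off-diagonal affinities are typically 1.
\<close>

lemma le_cam_mixture:
  fixes M :: "'x measure" and u :: "'x \<Rightarrow> real" and w q :: "'i \<Rightarrow> 'x \<Rightarrow> real" and g0 :: "'x \<Rightarrow> real"
    and a :: real
  assumes fin: "finite I" and ne: "I \<noteq> {}" and a: "a \<ge> 0"
    and [measurable]: "u \<in> borel_measurable M" "g0 \<in> borel_measurable M"
      "\<And>i. i \<in> I \<Longrightarrow> w i \<in> borel_measurable M" "\<And>i. i \<in> I \<Longrightarrow> q i \<in> borel_measurable M"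
    and u: "\<And>x. u x \<ge> 0" and g0: "\<And>x. g0 x > 0"
    and q: "\<And>i x. i \<in> I \<Longrightarrow> q i x \<ge> 0" and w: "\<And>i x. i \<in> I \<Longrightarrow> w i x \<ge> 0"
    and sep: "\<And>i x. i \<in> I \<Longrightarrow> a \<le> u x + w i x"
    and q1: "\<And>i. i \<in> I \<Longrightarrow> (\<integral>\<^sup>+x. ennreal (q i x) \<partial>M) = 1"
    and chi: "(\<Sum>i\<in>I. \<Sum>j\<in>I. \<integral>\<^sup>+x. ennreal (q i x * q j x / g0 x) \<partial>M) \<le> ennreal (2 * (real (card I))\<^sup>2)"
  shows "ennreal (a * real (card I) / 2)
    \<le> ennreal (real (card I)) * (\<integral>\<^sup>+x. ennreal (u x * g0 x) \<partial>M)
       + (\<Sum>i\<in>I. \<integral>\<^sup>+x. ennreal (w i x * q i x) \<partial>M)"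
proof -
  define N where "N = real (card I)"
  have N: "N > 0" using fin ne by (simp add: N_def card_gt_0_iff)
  let ?L = "ennreal N * (\<integral>\<^sup>+x. ennreal (u x * g0 x) \<partial>M) + (\<Sum>i\<in>I. \<integral>\<^sup>+x. ennreal (w i x * q i x) \<partial>M)"
  let ?X = "\<Sum>i\<in>I. \<Sum>j\<in>I. \<integral>\<^sup>+x. ennreal (q i x * q j x / g0 x) \<partial>M"
  have "ennreal (a * N) = ennreal a * (\<Sum>i\<in>I. \<integral>\<^sup>+x. ennreal (q i x) \<partial>M)"
    using q1 a by (simp add: N_def ennreal_mult ennreal_of_nat_eq_real_of_nat)
  also have "\<dots> = (\<integral>\<^sup>+x. ennreal (a * (\<Sum>i\<in>I. q i x)) \<partial>M)"
    using q a by (simp add: nn_integral_sum[symmetric] nn_integral_cmult[symmetric] ennreal_mult sum_nonneg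
        flip: sum_ennreal)
  also have "\<dots> \<le> (\<integral>\<^sup>+x. ennreal N * ennreal (u x * g0 x) + (\<Sum>i\<in>I. ennreal (w i x * q i x))
       + ennreal (a / (4 * N)) * (\<Sum>i\<in>I. \<Sum>j\<in>I. ennreal (q i x * q j x / g0 x)) \<partial>M)"
  proof (rule nn_integral_mono)
    fix x assume "x \<in> space M"
    have g0n: "g0 x \<ge> 0" using g0[of x] by simp
    have "ennreal (a * (\<Sum>i\<in>I. q i x)) \<le> ennreal (N * (u x * g0 x) + (\<Sum>i\<in>I. w i x * q i x)
        + a / (4 * N) * (\<Sum>i\<in>I. \<Sum>j\<in>I. q i x * q j x / g0 x))"
      by (intro ennreal_leI weighted_losses_ge_total_mass) (use fin u a g0 q w sep N in auto)
    also have "\<dots> = ennreal (N * (u x * g0 x)) + ennreal (\<Sum>i\<in>I. w i x * q i x)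
       + ennreal (a / (4 * N) * (\<Sum>i\<in>I. \<Sum>j\<in>I. q i x * q j x / g0 x))"
      using u[of x] a g0n q w N by (simp add: sum_nonneg)
    also have "ennreal (N * (u x * g0 x)) = ennreal N * ennreal (u x * g0 x)"
      using N u[of x] g0n by (intro ennreal_mult) auto
    also have "ennreal (\<Sum>i\<in>I. w i x * q i x) = (\<Sum>i\<in>I. ennreal (w i x * q i x))"
      using q w by (intro sum_ennreal[symmetric]) auto
    also have "ennreal (a / (4 * N) * (\<Sum>i\<in>I. \<Sum>j\<in>I. q i x * q j x / g0 x))
        = ennreal (a / (4 * N)) * (\<Sum>i\<in>I. \<Sum>j\<in>I. ennreal (q i x * q j x / g0 x))"
    proof -
      have "ennreal (\<Sum>i\<in>I. \<Sum>j\<in>I. q i x * q j x / g0 x)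
          = (\<Sum>i\<in>I. \<Sum>j\<in>I. ennreal (q i x * q j x / g0 x))"
        using q g0n by (simp add: sum_nonneg flip: sum_ennreal)
      then show ?thesis using a N q g0n by (subst ennreal_mult) (auto intro!: sum_nonneg)
    qed
    finally show "ennreal (a * (\<Sum>i\<in>I. q i x)) \<le> ennreal N * ennreal (u x * g0 x) + (\<Sum>i\<in>I. ennreal (w i x * q i x))
       + ennreal (a / (4 * N)) * (\<Sum>i\<in>I. \<Sum>j\<in>I. ennreal (q i x * q j x / g0 x))" .
  qed
  also have "\<dots> = ?L + ennreal (a / (4 * N)) * ?X"
    by (subst nn_integral_add, measurable, subst nn_integral_add, measurable)
       (simp add: nn_integral_cmult nn_integral_sum)
  also have "\<dots> \<le> ?L + ennreal (a / (4 * N)) * ennreal (2 * N\<^sup>2)"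
    using chi by (intro add_left_mono mult_left_mono) (auto simp: N_def)
  also have "ennreal (a / (4 * N)) * ennreal (2 * N\<^sup>2) = ennreal (a * N / 2)"
    using a N by (subst ennreal_mult[symmetric]) (auto simp: power2_eq_square field_simps)
  also have "ennreal (a * N) = ennreal (a * N / 2) + ennreal (a * N / 2)"
    using a N by (subst ennreal_plus[symmetric]) auto
  also have "?L + ennreal (a * N / 2) = ennreal (a * N / 2) + ?L" by (rule add.commute)
  finally have "ennreal (a * N / 2) + ennreal (a * N / 2) \<le> ennreal (a * N / 2) + ?L" .
  then show ?thesis unfolding N_def[symmetric] ennreal_add_left_cancel_le by simp
qed

section \<open>Gaussian models on forests\<close>

text \<open>
  Density of a vector built coordinate by coordinate: given the earlier ones, coordinate \<open>m\<close> is normal with mean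
  \<open>c m\<close> times its parent and standard deviation \<open>\<sigma> m\<close>. Where \<open>c m = 0\<close> the coordinate is a root and
  the value \<open>par m\<close> is irrelevant. The standard deviations are all 1 in the statistical models; the general
  form is kept because the chi-square integrand of two neighbouring models is again such a density,
  with one inflated root.
\<close>

definition forest_density ::
  "nat \<Rightarrow> (nat \<Rightarrow> nat) \<Rightarrow> (nat \<Rightarrow> real) \<Rightarrow> (nat \<Rightarrow> real) \<Rightarrow> (nat \<Rightarrow> real) \<Rightarrow> real" where
  "forest_density p par c \<sigma> x = (\<Prod>m<p. normal_density (c m * x (par m)) (\<sigma> m) (x m))"

abbreviation lborel_vec :: "nat \<Rightarrow> (nat \<Rightarrow> real) measure" where
  "lborel_vec p \<equiv> Pi\<^sub>M {..<p} (\<lambda>_. lborel)"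

interpretation lborel_prod: product_sigma_finite "\<lambda>_::nat. lborel :: real measure"
  by standard

lemma sigma_finite_lborel_vec: "sigma_finite_measure (lborel_vec p)"
  by (rule lborel_prod.sigma_finite) simp

lemma measurable_forest_density [measurable]:
  assumes "\<And>m. m < p \<Longrightarrow> c m \<noteq> 0 \<Longrightarrow> par m < m"
  shows "forest_density p par c \<sigma> \<in> borel_measurable (lborel_vec p)"
proof -
  have "(\<lambda>x. normal_density (c m * x (par m)) (\<sigma> m) (x m)) \<in> borel_measurable (lborel_vec p)"
    if "m < p" for m
  proof (cases "c m = 0")
    case True
    with that show ?thesis by (simp add: normal_density_def[abs_def])
  next
    case False
    with assms that have "par m < p" by (meson less_trans)
    with that have [measurable]: "(\<lambda>x. x m) \<in> borel_measurable (lborel_vec p)"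
        "(\<lambda>x. x (par m)) \<in> borel_measurable (lborel_vec p)"
      by (auto intro!: measurable_component_singleton[where M="\<lambda>_. lborel", simplified])
    have "normal_density (c m * x (par m)) (\<sigma> m) (x m) = normal_density 0 (\<sigma> m) (x m - c m * x (par m))" for x
      by (simp add: normal_density_def)
    then show ?thesis by simp
  qed
  then show ?thesis unfolding forest_density_def[abs_def] by (intro borel_measurable_prod) auto
qed

text \<open>
  The last coordinate has no children, so it integrates out to 1 and leaves the forest on
  the remaining coordinates.
\<close>

lemma nn_integral_forest_density:
  assumes "\<And>m. m < p \<Longrightarrow> c m \<noteq> 0 \<Longrightarrow> par m < m" and "\<And>m. \<sigma> m > 0"
  shows "(\<integral>\<^sup>+x. ennreal (forest_density p par c \<sigma> x) \<partial>lborel_vec p) = 1"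
  using assms(1)
proof (induction p)
  case 0
  then show ?case by (simp add: forest_density_def PiM_empty)
next
  case (Suc p)
  have par: "\<And>m. m < Suc p \<Longrightarrow> c m \<noteq> 0 \<Longrightarrow> par m < m" by (fact Suc.prems)
  have ins: "{..<Suc p} = insert p {..<p}" by (auto simp: lessThan_Suc)
  have meas: "(\<lambda>x. ennreal (forest_density (Suc p) par c \<sigma> x)) \<in> borel_measurable (Pi\<^sub>M (insert p {..<p}) (\<lambda>_. lborel))"
    using measurable_forest_density[OF par, of "Suc p"] unfolding ins by measurable
  have "(\<integral>\<^sup>+x. ennreal (forest_density (Suc p) par c \<sigma> x) \<partial>lborel_vec (Suc p))
    = (\<integral>\<^sup>+x. (\<integral>\<^sup>+y. ennreal (forest_density (Suc p) par c \<sigma> (x(p := y))) \<partial>lborel) \<partial>lborel_vec p)"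
    unfolding ins by (rule lborel_prod.product_nn_integral_insert[OF _ _ meas]) auto
  also have "\<dots> = (\<integral>\<^sup>+x. ennreal (forest_density p par c \<sigma> x) \<partial>lborel_vec p)"
  proof (rule nn_integral_cong)
    fix x :: "nat \<Rightarrow> real"
    have ker: "forest_density (Suc p) par c \<sigma> (x(p := y))
        = forest_density p par c \<sigma> x * normal_density (c p * x (par p)) (\<sigma> p) y" for y
    proof -
      have "normal_density (c m * (x(p := y)) (par m)) (\<sigma> m) ((x(p := y)) m)
          = normal_density (c m * x (par m)) (\<sigma> m) (x m)" if "m < p" for m
        using that par[of m] by (cases "c m = 0") auto
      then have "forest_density p par c \<sigma> (x(p := y)) = forest_density p par c \<sigma> x"
        unfolding forest_density_def by (intro prod.cong refl) auto
      moreover have "c p * (x(p := y)) (par p) = c p * x (par p)"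
        using par[of p] by (cases "c p = 0") auto
      moreover have "forest_density (Suc p) par c \<sigma> (x(p := y)) = forest_density p par c \<sigma> (x(p := y))
          * normal_density (c p * (x(p := y)) (par p)) (\<sigma> p) y"
        by (simp add: forest_density_def)
      ultimately show ?thesis by metis
    qed
    have nn: "forest_density p par c \<sigma> x \<ge> 0" by (simp add: forest_density_def prod_nonneg)
    have one: "(\<integral>\<^sup>+y. ennreal (normal_density (c p * x (par p)) (\<sigma> p) y) \<partial>lborel) = 1"
      using assms(2)[of p] by (subst nn_integral_eq_integral) auto
    show "(\<integral>\<^sup>+y. ennreal (forest_density (Suc p) par c \<sigma> (x(p := y))) \<partial>lborel)
        = ennreal (forest_density p par c \<sigma> x)"
      using nn one by (simp add: ker ennreal_mult nn_integral_cmult)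
  qed
  also have "\<dots> = 1" using Suc by simp
  finally show ?case .
qed

text \<open>
  The chi-square affinity of one edge: squaring the likelihood ratio of a shift doubles the shift and
  produces a factor depending on the parent alone.
\<close>

lemma normal_density_shift_ratio:
  fixes \<delta> s t :: real
  shows "normal_density (\<delta> * t) 1 s * normal_density (\<delta> * t) 1 s / normal_density 0 1 s
    = exp (\<delta>\<^sup>2 * t\<^sup>2) * normal_density (2 * \<delta> * t) 1 s"
  unfolding normal_density_def
  by (simp add: exp_add[symmetric] exp_diff[symmetric] field_simps power2_eq_square)

text \<open>
  That factor is absorbed into a standard normal parent by inflating its standard deviation; this is
  where a bound on the edge weight enters.
\<close>

lemma std_normal_density_tilt:
  fixes d t :: real
  assumes "2 * d\<^sup>2 < 1"
  defines "\<rho> \<equiv> 1 / sqrt (1 - 2 * d\<^sup>2)"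
  shows "exp (d\<^sup>2 * t\<^sup>2) * normal_density 0 1 t = \<rho> * normal_density 0 \<rho> t"
proof -
  have pos: "1 - 2 * d\<^sup>2 > 0" using assms(1) by simp
  then have r2: "\<rho>\<^sup>2 = 1 / (1 - 2 * d\<^sup>2)" and rp: "\<rho> > 0"
    by (auto simp: \<rho>_def power_divide)
  have "sqrt (2 * pi * \<rho>\<^sup>2) = sqrt (2 * pi) * \<rho>" using rp by (simp add: real_sqrt_mult)
  moreover have "exp (d\<^sup>2 * t\<^sup>2) * exp (- t\<^sup>2 / 2) = exp (- t\<^sup>2 / (2 * \<rho>\<^sup>2))"
    unfolding r2 exp_add[symmetric] using pos by (simp add: field_simps)
  ultimately show ?thesis using rp by (simp add: normal_density_def)
qed

definition edge_weight :: "real \<Rightarrow> nat set \<Rightarrow> nat \<Rightarrow> real" where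
  "edge_weight \<delta> S m = (if m \<in> S then \<delta> else 0)"

abbreviation forest :: "nat \<Rightarrow> (nat \<Rightarrow> nat) \<Rightarrow> real \<Rightarrow> nat set \<Rightarrow> (nat \<Rightarrow> real) \<Rightarrow> real" where
  "forest p par \<delta> S \<equiv> forest_density p par (edge_weight \<delta> S) (\<lambda>_. 1)"

lemma forest_pos: "forest p par \<delta> S x > 0"
  by (simp add: forest_density_def prod_pos normal_density_pos)

text \<open>
  Two different new edges interact trivially: the product of their likelihood ratios is the likelihood
  ratio of the forest with both edges, hence has integral 1.
\<close>

lemma forest_overlap_distinct:
  assumes "i \<notin> S" "j \<notin> S" "i \<noteq> j"
  shows "forest p par \<delta> (insert i S) x * forest p par \<delta> (insert j S) x / forest p par \<delta> S x
    = forest p par \<delta> (insert i (insert j S)) x"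
proof -
  have nz: "normal_density a 1 b \<noteq> 0" for a b
    using normal_density_pos[of 1 a b] by simp
  show ?thesis
    unfolding forest_density_def prod.distrib[symmetric] prod_dividef[symmetric]
    using assms by (intro prod.cong refl) (auto simp: edge_weight_def nz)
qed

text \<open>
  For the same new edge twice, the affinity integrand is \<open>\<rho>\<close> times a forest density, hence integrates to
  \<open>\<rho>\<close>. That the parent is a root of the old forest matters: only then is its coordinate standard normal, so
  that \<open>std_normal_density_tilt\<close> applies.
\<close>

lemma forest_overlap_same:
  assumes i: "i < p" "i \<notin> S" and j: "par i < i" "par i \<notin> S" and d: "2 * \<delta>\<^sup>2 < 1"
  defines "\<rho> \<equiv> 1 / sqrt (1 - 2 * \<delta>\<^sup>2)"
  shows "forest p par \<delta> (insert i S) x * forest p par \<delta> (insert i S) x / forest p par \<delta> S x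
    = \<rho> * forest_density p par ((edge_weight \<delta> S)(i := 2 * \<delta>)) ((\<lambda>_. 1)(par i := \<rho>)) x"
proof -
  have nz: "normal_density a 1 b \<noteq> 0" for a b
    using normal_density_pos[of 1 a b] by simp
  let ?c = "(edge_weight \<delta> S)(i := 2 * \<delta>)"
  let ?N = "\<lambda>\<sigma> m. normal_density (?c m * x (par m)) (\<sigma> m) (x m)"
  let ?E = "exp (\<delta>\<^sup>2 * (x (par i))\<^sup>2)"
  have "forest p par \<delta> (insert i S) x * forest p par \<delta> (insert i S) x / forest p par \<delta> S x
      = (\<Prod>m<p. (if m = i then ?E else 1) * ?N (\<lambda>_. 1) m)"
    unfolding forest_density_def prod.distrib[symmetric] prod_dividef[symmetric]
    using i normal_density_shift_ratio[of \<delta> "x (par i)" "x i"]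
    by (intro prod.cong refl) (auto simp: edge_weight_def nz)
  also have "\<dots> = ?E * (\<Prod>m<p. ?N (\<lambda>_. 1) m)"
    using i by (simp add: prod.distrib del: fun_upd_apply)
  \<comment> \<open>the exponential factor moves from the child's term of the product to the parent's\<close>
  also have "\<dots> = (\<Prod>m<p. (if m = par i then ?E else 1) * ?N (\<lambda>_. 1) m)"
    using i j by (simp add: prod.distrib del: fun_upd_apply)
  also have "\<dots> = (\<Prod>m<p. (if m = par i then \<rho> else 1) * ?N ((\<lambda>_. 1)(par i := \<rho>)) m)"
    using i j std_normal_density_tilt[OF d, of "x (par i)"]
    by (intro prod.cong refl) (auto simp: edge_weight_def \<rho>_def)
  also have "\<dots> = \<rho> * forest_density p par ?c ((\<lambda>_. 1)(par i := \<rho>)) x"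
    using i j by (simp add: prod.distrib forest_density_def del: fun_upd_apply)
  finally show ?thesis .
qed

text \<open>
  With \<open>y = 2 * d\<^sup>2 \<le> 1/2\<close> the squared inequality reads \<open>1 \<le> exp (2 * y) * (1 - y)\<close>, and already
  \<open>(1 + 2 * y) * (1 - y) \<ge> 1\<close>.
\<close>

lemma inverse_sqrt_le_exp:
  fixes d :: real
  assumes "\<bar>d\<bar> \<le> 1/2"
  shows "1 / sqrt (1 - 2 * d\<^sup>2) \<le> exp (2 * d\<^sup>2)"
proof -
  define y where "y = 2 * d\<^sup>2"
  have "d\<^sup>2 \<le> (1/2)\<^sup>2" using assms by (metis abs_ge_zero power2_abs power_mono)
  then have y: "0 \<le> y" "y \<le> 1/2" by (auto simp: y_def power2_eq_square)
  have "1 \<le> (1 + 2 * y) * (1 - y)"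
    using mult_nonneg_nonneg[of y "1 - 2 * y"] y by (simp add: algebra_simps)
  also have "\<dots> \<le> exp (2 * y) * (1 - y)"
    using y exp_ge_add_one_self[of "2 * y"] by (intro mult_right_mono) auto
  finally have "sqrt 1 \<le> sqrt (exp (2 * y) * (1 - y))" by (rule real_sqrt_le_mono)
  also have "\<dots> = exp y * sqrt (1 - y)"
  proof -
    have "exp (2 * y) = (exp y)\<^sup>2" by (simp add: power2_eq_square exp_add[symmetric])
    then show ?thesis by (simp add: real_sqrt_mult)
  qed
  finally show ?thesis using y by (simp add: y_def[symmetric] divide_le_eq)
qed

definition forest_law :: "nat \<Rightarrow> nat \<Rightarrow> (nat \<Rightarrow> nat) \<Rightarrow> real \<Rightarrow> nat set \<Rightarrow> (nat \<Rightarrow> nat \<Rightarrow> real) measure" where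
  "forest_law n p par \<delta> S = density (Pi\<^sub>M {..<n} (\<lambda>_. lborel_vec p)) (\<lambda>x. ennreal (\<Prod>s<n. forest p par \<delta> S (x s)))"

lemma product_sigma_finite_lborel_vec: "product_sigma_finite (\<lambda>_::nat. lborel_vec p)"
  by (simp add: product_sigma_finite_def sigma_finite_lborel_vec)

lemma nn_integral_iid:
  fixes g :: "(nat \<Rightarrow> real) \<Rightarrow> real"
  assumes [measurable]: "g \<in> borel_measurable (lborel_vec p)" and g: "\<And>x. g x \<ge> 0"
  shows "(\<integral>\<^sup>+x. ennreal (\<Prod>s<n. g (x s)) \<partial>Pi\<^sub>M {..<n} (\<lambda>_::nat. lborel_vec p))
    = (\<integral>\<^sup>+x. ennreal (g x) \<partial>lborel_vec p) ^ n"
proof -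
  interpret P: product_sigma_finite "\<lambda>_::nat. lborel_vec p" by (rule product_sigma_finite_lborel_vec)
  have "(\<integral>\<^sup>+x. ennreal (\<Prod>s<n. g (x s)) \<partial>Pi\<^sub>M {..<n} (\<lambda>_::nat. lborel_vec p))
    = (\<integral>\<^sup>+x. (\<Prod>s<n. ennreal (g (x s))) \<partial>Pi\<^sub>M {..<n} (\<lambda>_::nat. lborel_vec p))"
    using g by (simp add: prod_ennreal)
  also have "\<dots> = (\<Prod>s<n. \<integral>\<^sup>+x. ennreal (g x) \<partial>lborel_vec p)"
    by (rule P.product_nn_integral_prod) auto
  finally show ?thesis by simp
qed

text \<open>
  Le Cam's method for \<open>n\<close> observations of a forest \<open>S\<close> to which one unknown edge out of \<open>I\<close> may have been added.
  Per observation the affinities are 1 off the diagonal and \<open>\<rho>\<close> on it, so the second moment of the mixture's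
  likelihood ratio is \<open>(N - 1 + \<rho> ^ n) / N\<close> with \<open>N = card I\<close>; it is at most 2 as soon as
  \<open>\<rho> ^ n \<le> N + 1\<close>. Hence edges of weight of order \<open>sqrt (ln N / n)\<close> go unnoticed.
\<close>

lemma forest_edge_detection:
  fixes n p :: nat and u :: "(nat \<Rightarrow> nat \<Rightarrow> real) \<Rightarrow> real" and w :: "nat \<Rightarrow> (nat \<Rightarrow> nat \<Rightarrow> real) \<Rightarrow> real"
  defines "X \<equiv> Pi\<^sub>M {..<n} (\<lambda>_::nat. lborel_vec p)"
  assumes I: "I \<subseteq> {..<p}" "I \<noteq> {}" "I \<inter> S = {}"
    and par: "\<And>m. m \<in> I \<union> S \<Longrightarrow> par m < m" and root: "\<And>i. i \<in> I \<Longrightarrow> par i \<notin> S"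
    and d: "0 < \<delta>" "\<delta> \<le> 1/2" and few: "exp (2 * real n * \<delta>\<^sup>2) \<le> real (card I) + 1"
    and a: "a \<ge> 0"
    and meas: "u \<in> borel_measurable X" "\<And>i. i \<in> I \<Longrightarrow> w i \<in> borel_measurable X"
    and u: "\<And>x. u x \<ge> 0" and w: "\<And>i x. i \<in> I \<Longrightarrow> w i x \<ge> 0"
    and sep: "\<And>i x. i \<in> I \<Longrightarrow> a \<le> u x + w i x"
  shows "ennreal (a * real (card I) / 2)
    \<le> ennreal (real (card I)) * (\<integral>\<^sup>+x. ennreal (u x) \<partial>forest_law n p par \<delta> S)
       + (\<Sum>i\<in>I. \<integral>\<^sup>+x. ennreal (w i x) \<partial>forest_law n p par \<delta> (insert i S))"
proof -
  have fin: "finite I" using I by (meson finite_lessThan finite_subset)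
  define N where "N = card I"
  have N: "N \<ge> 1" using I fin by (simp add: N_def Suc_le_eq card_gt_0_iff)
  let ?g = "\<lambda>S x. \<Prod>s<n. forest p par \<delta> S (x s)"
  have pf: "par m < m" if "edge_weight \<delta> T m \<noteq> 0" "T \<subseteq> I \<union> S" for T m
    using that par by (auto simp: edge_weight_def split: if_splits)
  have m1: "forest p par \<delta> T \<in> borel_measurable (lborel_vec p)" if "T \<subseteq> I \<union> S" for T
    using pf that by (intro measurable_forest_density) auto
  have m2: "?g T \<in> borel_measurable X" if "T \<subseteq> I \<union> S" for T
    unfolding X_def using m1[OF that] by measurable
  have gp: "?g T x > 0" for T x by (simp add: prod_pos forest_pos)
  have gn: "?g T x \<ge> 0" for T x using gp[of T x] by simp
  have fn: "forest p par \<delta> T x \<ge> 0" for T x using forest_pos[of p par \<delta> T x] by simp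
  have g1: "(\<integral>\<^sup>+x. ennreal (?g T x) \<partial>X) = 1" if "T \<subseteq> I \<union> S" for T
  proof -
    have "(\<integral>\<^sup>+x. ennreal (forest p par \<delta> T x) \<partial>lborel_vec p) = 1"
      using pf that by (intro nn_integral_forest_density) auto
    then show ?thesis unfolding X_def using m1[OF that] fn by (simp add: nn_integral_iid)
  qed
  have law: "(\<integral>\<^sup>+x. ennreal (f x) \<partial>forest_law n p par \<delta> T) = (\<integral>\<^sup>+x. ennreal (f x * ?g T x) \<partial>X)"
    if "T \<subseteq> I \<union> S" "f \<in> borel_measurable X" "\<And>x. f x \<ge> 0" for T f
  proof -
    note [measurable] = m2[OF that(1)] that(2)
    have "(\<integral>\<^sup>+x. ennreal (f x) \<partial>forest_law n p par \<delta> T) = (\<integral>\<^sup>+x. ennreal (?g T x) * ennreal (f x) \<partial>X)"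
      unfolding forest_law_def X_def[symmetric] by (rule nn_integral_density) measurable
    also have "\<dots> = (\<integral>\<^sup>+x. ennreal (f x * ?g T x) \<partial>X)"
      using that(3) gn by (simp add: ennreal_mult mult.commute)
    finally show ?thesis .
  qed
  define \<rho> where "\<rho> = 1 / sqrt (1 - 2 * \<delta>\<^sup>2)"
  have "\<delta>\<^sup>2 \<le> (1/2)\<^sup>2" using d by (intro power_mono) auto
  then have d2: "2 * \<delta>\<^sup>2 < 1" by (simp add: power2_eq_square)
  have rp: "\<rho> > 0" using d2 by (simp add: \<rho>_def)
  have "\<rho> ^ n \<le> exp (2 * \<delta>\<^sup>2) ^ n"
    unfolding \<rho>_def using d d2 by (intro power_mono inverse_sqrt_le_exp) auto
  also have "\<dots> = exp (2 * real n * \<delta>\<^sup>2)" by (simp add: exp_of_nat_mult[symmetric] mult_ac)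
  also have "\<dots> \<le> real N + 1" using few by (simp add: N_def)
  finally have rn: "\<rho> ^ n \<le> real N + 1" .
  have chi: "(\<integral>\<^sup>+x. ennreal (?g (insert i S) x * ?g (insert j S) x / ?g S x) \<partial>X)
      = ennreal (if i = j then \<rho> ^ n else 1)" if ij: "i \<in> I" "j \<in> I" for i j
  proof -
    let ?r = "\<lambda>x. forest p par \<delta> (insert i S) x * forest p par \<delta> (insert j S) x / forest p par \<delta> S x"
    have [measurable]: "forest p par \<delta> (insert i S) \<in> borel_measurable (lborel_vec p)"
      "forest p par \<delta> (insert j S) \<in> borel_measurable (lborel_vec p)"
      "forest p par \<delta> S \<in> borel_measurable (lborel_vec p)"
      using ij by (auto intro!: m1)
    have "(\<integral>\<^sup>+x. ennreal (?g (insert i S) x * ?g (insert j S) x / ?g S x) \<partial>X)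
        = (\<integral>\<^sup>+x. ennreal (\<Prod>s<n. ?r (x s)) \<partial>X)"
      by (simp add: prod.distrib prod_dividef)
    also have "\<dots> = (\<integral>\<^sup>+x. ennreal (?r x) \<partial>lborel_vec p) ^ n"
      unfolding X_def by (rule nn_integral_iid) (auto simp: fn)
    also have "(\<integral>\<^sup>+x. ennreal (?r x) \<partial>lborel_vec p) = ennreal (if i = j then \<rho> else 1)"
    proof (cases "i = j")
      case True
      have j: "j < p" "j \<notin> S" "par j < j" "par j \<notin> S" using ij I par root by auto
      let ?c = "(edge_weight \<delta> S)(j := 2 * \<delta>)" and ?\<sigma> = "(\<lambda>_. 1)(par j := \<rho>)"
      have pc: "par m < m" if "?c m \<noteq> 0" for m
        using that j par by (auto simp: edge_weight_def split: if_splits)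
      have nn: "forest_density p par ?c ?\<sigma> x \<ge> 0" for x
        unfolding forest_density_def by (simp add: prod_nonneg)
      have [measurable]: "forest_density p par ?c ?\<sigma> \<in> borel_measurable (lborel_vec p)"
        using pc by (intro measurable_forest_density) blast
      have one: "(\<integral>\<^sup>+x. ennreal (forest_density p par ?c ?\<sigma> x) \<partial>lborel_vec p) = 1"
        using pc rp by (intro nn_integral_forest_density) auto
      have "(\<integral>\<^sup>+x. ennreal (?r x) \<partial>lborel_vec p)
        = (\<integral>\<^sup>+x. ennreal \<rho> * ennreal (forest_density p par ?c ?\<sigma> x) \<partial>lborel_vec p)"
        unfolding True forest_overlap_same[where par = par, OF j d2] \<rho>_def[symmetric]
        using rp nn by (simp add: ennreal_mult)
      then show ?thesis using True one by (simp add: nn_integral_cmult)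
    next
      case False
      have "i \<notin> S" "j \<notin> S" using ij I by auto
      then show ?thesis
        unfolding forest_overlap_distinct[OF \<open>i \<notin> S\<close> \<open>j \<notin> S\<close> False] using False pf ij
        by (auto intro!: nn_integral_forest_density)
    qed
    finally show ?thesis using rp by (simp add: ennreal_power)
  qed
  have tot: "(\<Sum>i\<in>I. \<Sum>j\<in>I. \<integral>\<^sup>+x. ennreal (?g (insert i S) x * ?g (insert j S) x / ?g S x) \<partial>X)
      \<le> ennreal (2 * (real N)\<^sup>2)"
  proof -
    have "(\<Sum>i\<in>I. \<Sum>j\<in>I. \<integral>\<^sup>+x. ennreal (?g (insert i S) x * ?g (insert j S) x / ?g S x) \<partial>X)
      = (\<Sum>i\<in>I. \<Sum>j\<in>I. ennreal (if i = j then \<rho> ^ n else 1))"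
      by (intro sum.cong refl chi)
    also have "\<dots> = ennreal (\<Sum>i\<in>I. \<Sum>j\<in>I. if i = j then \<rho> ^ n else 1)"
      using rp by (simp add: sum_ennreal sum_nonneg)
    also have "(\<Sum>i\<in>I. \<Sum>j\<in>I. if i = j then \<rho> ^ n else 1) = (\<Sum>i\<in>I. \<rho> ^ n + (real N - 1))"
    proof (intro sum.cong refl)
      fix i assume i: "i \<in> I"
      have "(\<Sum>j\<in>I. if i = j then \<rho> ^ n else 1) = \<rho> ^ n + (\<Sum>j\<in>I - {i}. 1)"
        using fin i by (simp add: sum.remove[of I i])
      also have "(\<Sum>j\<in>I - {i}. 1::real) = real N - 1"
        using fin i N by (simp add: N_def of_nat_diff)
      finally show "(\<Sum>j\<in>I. if i = j then \<rho> ^ n else 1) = \<rho> ^ n + (real N - 1)" .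
    qed
    also have "\<dots> = real N * (\<rho> ^ n + (real N - 1))" by (simp add: N_def)
    also have "\<dots> \<le> real N * (2 * real N)" using rn by (intro mult_left_mono) auto
    also have "\<dots> = 2 * (real N)\<^sup>2" by (simp add: power2_eq_square)
    finally show ?thesis by (simp add: ennreal_leI)
  qed
  have lhs: "(\<integral>\<^sup>+x. ennreal (u x) \<partial>forest_law n p par \<delta> S) = (\<integral>\<^sup>+x. ennreal (u x * ?g S x) \<partial>X)"
    using u meas by (intro law) auto
  have rhs: "(\<integral>\<^sup>+x. ennreal (w i x) \<partial>forest_law n p par \<delta> (insert i S))
      = (\<integral>\<^sup>+x. ennreal (w i x * ?g (insert i S) x) \<partial>X)" if "i \<in> I" for i
    using w meas that by (intro law) auto
  have "ennreal (a * real (card I) / 2)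
    \<le> ennreal (real (card I)) * (\<integral>\<^sup>+x. ennreal (u x * ?g S x) \<partial>X)
       + (\<Sum>i\<in>I. \<integral>\<^sup>+x. ennreal (w i x * ?g (insert i S) x) \<partial>X)"
  proof (rule le_cam_mixture)
    show "?g S \<in> borel_measurable X" by (rule m2) simp
    show "?g (insert i S) \<in> borel_measurable X" if "i \<in> I" for i using that by (intro m2) auto
    show "(\<integral>\<^sup>+x. ennreal (?g (insert i S) x) \<partial>X) = 1" if "i \<in> I" for i using that by (intro g1) auto
    show "(\<Sum>i\<in>I. \<Sum>j\<in>I. \<integral>\<^sup>+x. ennreal (?g (insert i S) x * ?g (insert j S) x / ?g S x) \<partial>X)
      \<le> ennreal (2 * (real (card I))\<^sup>2)" using tot by (simp add: N_def)
  qed (use fin I a u w sep gp gn in \<open>auto simp: meas\<close>)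
  then show ?thesis using lhs rhs by simp
qed

section \<open>Precision matrices of forests\<close>

definition forest_mat :: "nat \<Rightarrow> (nat \<Rightarrow> nat) \<Rightarrow> (nat \<Rightarrow> real) \<Rightarrow> real mat" where
  "forest_mat p par c = Matrix.mat p p (\<lambda>(i, j). if j = par i then c i else 0)"

definition forest_precision :: "nat \<Rightarrow> (nat \<Rightarrow> nat) \<Rightarrow> (nat \<Rightarrow> real) \<Rightarrow> real mat" where
  "forest_precision p par c =
     transpose_mat (1\<^sub>m p - forest_mat p par c) * (1\<^sub>m p - forest_mat p par c)"

lemma forest_mat_carrier [simp]: "forest_mat p par c \<in> carrier_mat p p"
  by (simp add: forest_mat_def)

lemma forest_factor_carrier: "1\<^sub>m p - forest_mat p par c \<in> carrier_mat p p"
  by (intro minus_carrier_mat) simp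

lemma forest_precision_carrier [simp]: "forest_precision p par c \<in> carrier_mat p p"
  unfolding forest_precision_def
  by (intro mult_carrier_mat[of _ p p] transpose_carrier_mat[THEN iffD2] forest_factor_carrier)

text \<open>
  The conditional on the right keeps \<open>par i\<close> out of the formula for roots, where it may
  exceed the dimension.
\<close>

lemma forest_mat_mult_vec:
  assumes "i < p" and "c i \<noteq> 0 \<Longrightarrow> par i < i" and v: "v \<in> carrier_vec p"
  shows "((1\<^sub>m p - forest_mat p par c) *\<^sub>v v) $ i = v $ i - c i * (if c i = 0 then 0 else v $ par i)"
proof -
  have "((1\<^sub>m p - forest_mat p par c) *\<^sub>v v) $ i
      = (\<Sum>j\<in>{0..<p}. (if i = j then v $ j else 0) - (if j = par i then c i * v $ j else 0))"
    using assms by (auto simp: scalar_prod_def forest_mat_def algebra_simps intro!: sum.cong)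
  also have "\<dots> = v $ i - (\<Sum>j\<in>{0..<p}. (if j = par i then c i * v $ j else 0))"
    using assms by (simp add: sum_subtractf)
  also have "(\<Sum>j\<in>{0..<p}. (if j = par i then c i * v $ j else 0)) = c i * (if c i = 0 then 0 else v $ par i)"
  proof (cases "c i = 0")
    case False
    then have "par i < p" using assms by (meson less_trans)
    with False show ?thesis by simp
  qed (simp cong: if_cong)
  finally show ?thesis .
qed

lemma scalar_prod_self: "v \<in> carrier_vec p \<Longrightarrow> scalar_prod v v = (\<Sum>i<p. (v $ i)\<^sup>2)" for v :: "real vec"
  by (simp add: scalar_prod_def power2_eq_square atLeast0LessThan)

lemma gram_quadratic_form:
  fixes B :: "real mat"
  assumes B: "B \<in> carrier_mat p p" and v: "v \<in> carrier_vec p"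
  shows "scalar_prod v (transpose_mat B * B *\<^sub>v v) = scalar_prod (B *\<^sub>v v) (B *\<^sub>v v)"
proof -
  have Bv: "B *\<^sub>v v \<in> carrier_vec p" using B v by (rule mult_mat_vec_carrier)
  have "transpose_mat B * B *\<^sub>v v = transpose_mat B *\<^sub>v (B *\<^sub>v v)"
    using B v by (intro assoc_mult_mat_vec) auto
  then have "scalar_prod v (transpose_mat B * B *\<^sub>v v) = scalar_prod (transpose_mat B *\<^sub>v (B *\<^sub>v v)) v"
    using B v Bv by (simp add: comm_scalar_prod[of v p])
  also have "\<dots> = scalar_prod (B *\<^sub>v v) (B *\<^sub>v v)"
    using transpose_vec_mult_scalar[OF B v Bv] .
  finally show ?thesis .
qed

lemma forest_quadratic_form:
  assumes par: "\<And>i. i < p \<Longrightarrow> c i \<noteq> 0 \<Longrightarrow> par i < i" and v: "v \<in> carrier_vec p"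
  shows "scalar_prod v (forest_precision p par c *\<^sub>v v)
    = (\<Sum>i<p. (v $ i - c i * (if c i = 0 then 0 else v $ par i))\<^sup>2)"
proof -
  have B: "1\<^sub>m p - forest_mat p par c \<in> carrier_mat p p" by (rule forest_factor_carrier)
  show ?thesis
    unfolding forest_precision_def gram_quadratic_form[OF B v]
    using forest_mat_mult_vec[of _ p c par v] par v B
    by (subst scalar_prod_self[of _ p]) (auto intro!: sum.cong)
qed

text \<open>
  The factor is unit lower triangular. Consequently all forest models share the normalising constant of
  the standard normal distribution.
\<close>

lemma det_forest_factor:
  assumes par: "\<And>i. i < p \<Longrightarrow> c i \<noteq> 0 \<Longrightarrow> par i < i"
  shows "Determinant.det (1\<^sub>m p - forest_mat p par c) = 1"
proof -
  have "Determinant.det (1\<^sub>m p - forest_mat p par c) = prod_list (diag_mat (1\<^sub>m p - forest_mat p par c))"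
  proof (rule det_lower_triangular[of p])
    fix i j assume ij: "i < j" "j < p"
    then have "c i = 0 \<or> j \<noteq> par i" using par[of i] by auto
    then show "(1\<^sub>m p - forest_mat p par c) $$ (i, j) = 0" using ij by (auto simp: forest_mat_def)
  qed (rule forest_factor_carrier)
  also have "\<dots> = (\<Prod>i = 0..<p. (1\<^sub>m p - forest_mat p par c) $$ (i, i))"
    by (simp add: prod_list_diag_prod forest_mat_def)
  also have "\<dots> = (\<Prod>i = 0..<p. 1)"
  proof (intro prod.cong refl)
    fix i assume i: "i \<in> {0..<p}"
    then have "c i = 0 \<or> i \<noteq> par i" using par[of i] by auto
    then show "(1\<^sub>m p - forest_mat p par c) $$ (i, i) = 1" using i by (auto simp: forest_mat_def)
  qed
  finally show ?thesis by simp
qed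

lemma det_forest_precision:
  assumes par: "\<And>i. i < p \<Longrightarrow> c i \<noteq> 0 \<Longrightarrow> par i < i"
  shows "Determinant.det (forest_precision p par c) = 1"
proof -
  have B: "1\<^sub>m p - forest_mat p par c \<in> carrier_mat p p" by (rule forest_factor_carrier)
  show ?thesis
    unfolding forest_precision_def using B det_forest_factor[where p = p and c = c and par = par, OF par]
    by (simp add: det_mult[of _ p] det_transpose)
qed

lemma inv_mat_inverse:
  fixes M :: "real mat"
  assumes M: "M \<in> carrier_mat p p" and d: "Determinant.det M \<noteq> 0"
  shows "inv_mat M \<in> carrier_mat p p" "M * inv_mat M = 1\<^sub>m p" "inv_mat M * M = 1\<^sub>m p"
proof -
  have "M \<in> Units (ring_mat TYPE(real) p ())" by (rule det_non_zero_imp_unit[OF M d])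
  then obtain B where "mat_inverse M = Some B" using mat_inverse(1)[OF M, where b = "()"] by (cases "mat_inverse M") auto
  then show "inv_mat M \<in> carrier_mat p p" "M * inv_mat M = 1\<^sub>m p" "inv_mat M * M = 1\<^sub>m p"
    using mat_inverse(2)[OF M] by (auto simp: inv_mat_def)
qed

lemma inv_mat_unique:
  fixes M :: "real mat"
  assumes M: "M \<in> carrier_mat p p" and N: "N \<in> carrier_mat p p" and MN: "M * N = 1\<^sub>m p"
  shows "inv_mat M = N"
proof -
  have "Determinant.det M * Determinant.det N = 1" using det_mult[OF M N] MN by simp
  then have "Determinant.det M \<noteq> 0" by auto
  note I = inv_mat_inverse[OF M this]
  have "inv_mat M = inv_mat M * (M * N)" using I MN by simp
  also have "\<dots> = (inv_mat M * M) * N" using I(1) M N by (simp add: assoc_mult_mat[of _ p p _ p _ p])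
  also have "\<dots> = N" using I N by simp
  finally show ?thesis .
qed

lemma inv_mat_one: "inv_mat (1\<^sub>m p) = 1\<^sub>m p"
  by (rule inv_mat_unique[of _ p]) auto

lemma inv_mat_inv_mat:
  fixes M :: "real mat"
  assumes M: "M \<in> carrier_mat p p" and d: "Determinant.det M \<noteq> 0"
  shows "inv_mat (inv_mat M) = M"
  using inv_mat_inverse[OF assms] M by (intro inv_mat_unique[of _ p])

lemma det_inv_mat:
  fixes M :: "real mat"
  assumes M: "M \<in> carrier_mat p p" and d: "Determinant.det M = 1"
  shows "Determinant.det (inv_mat M) = 1"
proof -
  have "Determinant.det M \<noteq> 0" using d by simp
  note I = inv_mat_inverse[OF M this]
  show ?thesis using det_mult[OF M I(1)] I(2) d by simp
qed

lemma pos_def_forest_precision: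
  assumes par: "\<And>i. i < p \<Longrightarrow> c i \<noteq> 0 \<Longrightarrow> par i < i"
  shows "pos_def p (forest_precision p par c)"
  unfolding pos_def_def
proof (intro conjI ballI impI)
  let ?B = "1\<^sub>m p - forest_mat p par c"
  have B: "?B \<in> carrier_mat p p" by (rule forest_factor_carrier)
  show "transpose_mat (forest_precision p par c) = forest_precision p par c"
    unfolding forest_precision_def using B by (simp add: transpose_mult[of _ p p _ p])
  fix v :: "real vec" assume v: "v \<in> carrier_vec p" "v \<noteq> 0\<^sub>v p"
  let ?w = "\<lambda>i. v $ i - c i * (if c i = 0 then 0 else v $ par i)"
  have "(\<Sum>i<p. (?w i)\<^sup>2) \<noteq> 0"
  proof
    assume "(\<Sum>i<p. (?w i)\<^sup>2) = 0"
    then have w: "?w i = 0" if "i < p" for i using that by (simp add: sum_nonneg_eq_0_iff)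
    have "v $ i = 0" if "i < p" for i
      using that
    proof (induction i rule: less_induct)
      case (less i)
      show ?case
      proof (cases "c i = 0")
        case False
        then have "v $ par i = 0" using less par by (meson less_trans)
        then show ?thesis using w[OF less.prems] by simp
      qed (use w[OF less.prems] in simp)
    qed
    then have "v = 0\<^sub>v p" using v by (intro eq_vecI) auto
    then show False using v by simp
  qed
  moreover have "(\<Sum>i<p. (?w i)\<^sup>2) \<ge> 0" by (simp add: sum_nonneg)
  moreover have "scalar_prod v (forest_precision p par c *\<^sub>v v) = (\<Sum>i<p. (?w i)\<^sup>2)"
    using par v by (intro forest_quadratic_form) auto
  ultimately show "scalar_prod v (forest_precision p par c *\<^sub>v v) > 0" by linarith
qed simp

text \<open>
  The triangle inequality for \<open>v - z\<close> in squared form; the cross term is controlled by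
  \<open>2 * r * (v i * z i) \<le> r\<^sup>2 * (v i)\<^sup>2 + (z i)\<^sup>2\<close>.
\<close>

lemma sum_square_perturbation:
  fixes v z :: "nat \<Rightarrow> real"
  assumes r: "0 < r" "r \<le> 1" and z: "(\<Sum>i<p. (z i)\<^sup>2) \<le> r\<^sup>2 * (\<Sum>i<p. (v i)\<^sup>2)"
  shows "(1 - r)\<^sup>2 * (\<Sum>i<p. (v i)\<^sup>2) \<le> (\<Sum>i<p. (v i - z i)\<^sup>2)"
    and "(\<Sum>i<p. (v i - z i)\<^sup>2) \<le> (1 + r)\<^sup>2 * (\<Sum>i<p. (v i)\<^sup>2)"
proof -
  define V where "V = (\<Sum>i<p. (v i)\<^sup>2)"
  define Z where "Z = (\<Sum>i<p. (z i)\<^sup>2)"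
  define W where "W = (\<Sum>i<p. v i * z i)"
  have exp: "(\<Sum>i<p. (v i - z i)\<^sup>2) = V - 2 * W + Z"
    by (simp add: V_def Z_def W_def power2_diff sum.distrib sum_subtractf sum_distrib_left mult_ac)
  have pt: "2 * r * \<bar>a * b\<bar> \<le> r\<^sup>2 * a\<^sup>2 + b\<^sup>2" for a b :: real
  proof -
    have "0 \<le> (r * \<bar>a\<bar> - \<bar>b\<bar>)\<^sup>2" by simp
    then show ?thesis by (simp add: power2_diff power_mult_distrib abs_mult mult_ac)
  qed
  have "2 * r * \<bar>W\<bar> \<le> 2 * r * (\<Sum>i<p. \<bar>v i * z i\<bar>)"
    unfolding W_def using r by (intro mult_left_mono sum_abs) auto
  also have "\<dots> \<le> (\<Sum>i<p. r\<^sup>2 * (v i)\<^sup>2 + (z i)\<^sup>2)"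
    unfolding sum_distrib_left by (intro sum_mono pt)
  also have "\<dots> = r\<^sup>2 * V + Z" by (simp add: sum.distrib V_def Z_def sum_distrib_left)
  finally have cs: "2 * r * \<bar>W\<bar> \<le> r\<^sup>2 * V + Z" .
  have Z: "Z \<le> r\<^sup>2 * V" using z by (simp add: V_def Z_def)
  have W1: "2 * r * W \<le> r\<^sup>2 * V + Z" "- (2 * r * W) \<le> r\<^sup>2 * V + Z"
  proof -
    have "2 * r * W \<le> 2 * r * \<bar>W\<bar>" by (rule mult_left_mono) (use r in auto)
    moreover have "2 * r * (- W) \<le> 2 * r * \<bar>W\<bar>" by (rule mult_left_mono) (use r in auto)
    ultimately show "2 * r * W \<le> r\<^sup>2 * V + Z" "- (2 * r * W) \<le> r\<^sup>2 * V + Z" using cs by (simp_all only: mult_minus_right)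
  qed
  have "(1 - r) * Z \<le> (1 - r) * (r\<^sup>2 * V)" using r Z by (intro mult_left_mono) auto
  then have "r * ((1 - r)\<^sup>2 * V) \<le> r * (V - 2 * W + Z)"
    using W1(1) by (simp add: power2_eq_square algebra_simps)
  then show "(1 - r)\<^sup>2 * (\<Sum>i<p. (v i)\<^sup>2) \<le> (\<Sum>i<p. (v i - z i)\<^sup>2)"
    using r by (simp add: exp V_def)
  have "(1 + r) * Z \<le> (1 + r) * (r\<^sup>2 * V)" using r Z by (intro mult_left_mono) auto
  then have "r * (V - 2 * W + Z) \<le> r * ((1 + r)\<^sup>2 * V)"
    using W1(2) by (simp add: power2_eq_square algebra_simps)
  then show "(\<Sum>i<p. (v i - z i)\<^sup>2) \<le> (1 + r)\<^sup>2 * (\<Sum>i<p. (v i)\<^sup>2)"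
    using r by (simp add: exp V_def)
qed

text \<open>
  The quadratic form is the squared norm of \<open>v - A v\<close>, and \<open>A\<close> has Frobenius norm \<open>\<bar>\<delta>\<bar> * sqrt (card S)\<close>; so
  an eigenvalue, being a Rayleigh quotient, stays within \<open>(1 - r)\<^sup>2\<close> and \<open>(1 + r)\<^sup>2\<close>.
\<close>

lemma forest_spectrum_bounds:
  assumes par: "\<And>m. m \<in> S \<Longrightarrow> par m < m" and S: "S \<subseteq> {..<p}"
    and r: "0 < r" "r \<le> 1" and small: "real (card S) * \<delta>\<^sup>2 \<le> r\<^sup>2"
    and lam: "l \<in> spectrum (forest_precision p par (edge_weight \<delta> S))"
  shows "(1 - r)\<^sup>2 \<le> l \<and> l \<le> (1 + r)\<^sup>2"
proof -
  let ?c = "edge_weight \<delta> S"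
  let ?\<Omega> = "forest_precision p par ?c"
  have pc: "par i < i" if "?c i \<noteq> 0" for i using that par by (auto simp: edge_weight_def split: if_splits)
  have dim: "dim_row ?\<Omega> = p" using forest_precision_carrier[of p par ?c] by blast
  obtain v where v: "v \<in> carrier_vec p" "v \<noteq> 0\<^sub>v p" "?\<Omega> *\<^sub>v v = l \<cdot>\<^sub>v v"
    using lam dim unfolding spectrum_def eigenvalue_def eigenvector_def by auto
  define z where "z i = ?c i * (if ?c i = 0 then 0 else v $ par i)" for i
  let ?V = "\<Sum>i<p. (v $ i)\<^sup>2"
  have "?V \<noteq> 0"
  proof
    assume "?V = 0"
    then have "v $ i = 0" if "i < p" for i using that by (simp add: sum_nonneg_eq_0_iff)
    then have "v = 0\<^sub>v p" using v by (intro eq_vecI) auto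
    then show False using v by simp
  qed
  then have V: "?V > 0" by (metis less_eq_real_def sum_nonneg zero_le_power2)
  have "(\<Sum>i<p. (z i)\<^sup>2) = (\<Sum>i\<in>S. (z i)\<^sup>2)"
    using S by (intro sum.mono_neutral_right) (auto simp: z_def edge_weight_def)
  also have "\<dots> \<le> (\<Sum>i\<in>S. \<delta>\<^sup>2 * ?V)"
  proof (rule sum_mono)
    fix i assume i: "i \<in> S"
    then have "par i < p" using S par[of i] by (auto intro: less_trans)
    then have "(v $ par i)\<^sup>2 \<le> ?V" by (intro member_le_sum) auto
    then show "(z i)\<^sup>2 \<le> \<delta>\<^sup>2 * ?V"
      using i V by (auto simp: z_def edge_weight_def power_mult_distrib intro!: mult_left_mono)
  qed
  also have "\<dots> = real (card S) * \<delta>\<^sup>2 * ?V" by simp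
  also have "\<dots> \<le> r\<^sup>2 * ?V" using small V by (intro mult_right_mono) auto
  finally have z: "(\<Sum>i<p. (z i)\<^sup>2) \<le> r\<^sup>2 * ?V" .
  have "l * ?V = scalar_prod v (?\<Omega> *\<^sub>v v)" using v by (simp add: scalar_prod_self[of v p])
  also have "\<dots> = (\<Sum>i<p. (v $ i - z i)\<^sup>2)"
    unfolding z_def using pc v by (intro forest_quadratic_form) auto
  finally have "l * ?V = (\<Sum>i<p. (v $ i - z i)\<^sup>2)" .
  then have "(1 - r)\<^sup>2 * ?V \<le> l * ?V" "l * ?V \<le> (1 + r)\<^sup>2 * ?V"
    using sum_square_perturbation[OF r z] by simp_all
  then show ?thesis using V by simp
qed

text \<open>
  An isolated coordinate gives an eigenvector. It makes the spectrum nonempty, without which the minimum and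
  maximum that define the extreme eigenvalues would carry no information.
\<close>

lemma one_in_forest_spectrum:
  assumes m: "m < p" "m \<notin> S" "m \<notin> par ` S"
  shows "1 \<in> spectrum (forest_precision p par (edge_weight \<delta> S))"
proof -
  let ?B = "1\<^sub>m p - forest_mat p par (edge_weight \<delta> S)"
  have B: "?B \<in> carrier_mat p p" by (rule forest_factor_carrier)
  have u: "(unit_vec p m :: real vec) \<in> carrier_vec p" by simp
  have "?B *\<^sub>v unit_vec p m = unit_vec p m"
  proof (rule eq_vecI)
    fix i assume "i < dim_vec (unit_vec p m)"
    then show "(?B *\<^sub>v unit_vec p m) $ i = unit_vec p m $ i"
      using m B by (auto simp: forest_mat_def edge_weight_def scalar_prod_right_unit[of _ p] row_def)
  qed (use B in auto)
  moreover have "transpose_mat ?B *\<^sub>v unit_vec p m = unit_vec p m"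
  proof (rule eq_vecI)
    fix i assume "i < dim_vec (unit_vec p m)"
    then show "(transpose_mat ?B *\<^sub>v unit_vec p m) $ i = unit_vec p m $ i"
      using m B by (auto simp: forest_mat_def edge_weight_def scalar_prod_right_unit[of _ p] col_def)
  qed (use B in auto)
  ultimately have "forest_precision p par (edge_weight \<delta> S) *\<^sub>v unit_vec p m = unit_vec p m"
    unfolding forest_precision_def using B u
    by (subst assoc_mult_mat_vec[of _ p p _ p]) auto
  moreover have "(unit_vec p m :: real vec) \<noteq> 0\<^sub>v p"
    using m by (metis index_unit_vec(2) index_zero_vec(1) zero_neq_one)
  moreover have "dim_row (forest_precision p par (edge_weight \<delta> S)) = p"
    using forest_precision_carrier by blast
  ultimately show ?thesis
    unfolding spectrum_def eigenvalue_def eigenvector_def by (auto intro!: exI[of _ "unit_vec p m"])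
qed

lemma is_mcd_forest:
  assumes par: "\<And>i. i < p \<Longrightarrow> c i \<noteq> 0 \<Longrightarrow> par i < i"
  shows "is_mcd p (forest_precision p par c) (forest_mat p par c) (1\<^sub>m p)"
  unfolding is_mcd_def
proof (intro conjI allI impI)
  fix i j assume "i < p" "j < p" "i \<le> j"
  moreover from this have "c i = 0 \<or> j \<noteq> par i" using par[of i] by auto
  ultimately show "forest_mat p par c $$ (i, j) = 0" by (auto simp: forest_mat_def)
next
  show "forest_precision p par c = transpose_mat (1\<^sub>m p - forest_mat p par c) * inv_mat (1\<^sub>m p) * (1\<^sub>m p - forest_mat p par c)"
    using forest_factor_carrier[of p par c]
    by (simp add: forest_precision_def inv_mat_one right_mult_one_mat[of _ p p])
qed (auto simp: diagonal_mat_def)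

text \<open>
  Each row has at most one nonzero entry, so the row sums outside the band are at most one edge weight, however
  many edges there are. This is why a whole column of \<open>A\<close> can be filled at small cost in the
  \<open>\<gamma>\<close>-constraint.
\<close>

lemma inf_norm_forest_tail:
  assumes p: "p > 0" and g: "g \<ge> 0" and d: "\<delta> \<ge> 0"
    and tail: "\<And>i. i \<in> S \<Longrightarrow> i < p \<Longrightarrow> par i < i \<and> (k < i - par i \<longrightarrow> \<delta> \<le> g)"
  shows "inf_norm_mat (forest_mat p par (edge_weight \<delta> S) - banding k (forest_mat p par (edge_weight \<delta> S))) \<le> g"
proof -
  let ?A = "forest_mat p par (edge_weight \<delta> S)"
  let ?M = "?A - banding k ?A"
  have dim: "dim_row ?M = p" "dim_col ?M = p" by (auto simp: banding_def forest_mat_def)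
  have "(\<Sum>j<p. \<bar>?M $$ (i, j)\<bar>) \<le> g" if i: "i < p" for i
  proof -
    have "\<bar>?M $$ (i, j)\<bar> \<le> (if j = par i then g else 0)" if "j < p" for j
      using i that g d tail[of i] by (auto simp: banding_def forest_mat_def edge_weight_def)
    then have "(\<Sum>j<p. \<bar>?M $$ (i, j)\<bar>) \<le> (\<Sum>j<p. if j = par i then g else 0)"
      by (intro sum_mono) auto
    also have "\<dots> \<le> g" using g by simp
    finally show ?thesis .
  qed
  then show ?thesis unfolding inf_norm_mat_def dim using p by (intro Max.boundedI) auto
qed

text \<open>
  With \<open>r = 1 - sqrt e\<close> the lower eigenvalue bound \<open>(1 - r)\<^sup>2\<close> is exactly \<open>e\<close>, and
  \<open>(1 + r)\<^sup>2 \<le> 1 / e\<close> follows from \<open>(2 - s) * s \<le> 1\<close> at \<open>s = sqrt e\<close>.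
\<close>

lemma forest_in_precision_class:
  assumes eps: "0 < e" "e < 1" and par: "\<And>m. m \<in> S \<Longrightarrow> par m < m" and S: "S \<subseteq> {..<p}"
    and free: "m < p" "m \<notin> S" "m \<notin> par ` S"
    and d: "\<delta> \<ge> 0" and small: "real (card S) * \<delta>\<^sup>2 \<le> (1 - sqrt e)\<^sup>2"
    and \<gamma>: "\<And>k. k > 0 \<Longrightarrow> \<gamma> k \<ge> 0"
    and tail: "\<And>k i. k > 0 \<Longrightarrow> i \<in> S \<Longrightarrow> k < i - par i \<Longrightarrow> \<delta> \<le> \<gamma> k"
  shows "forest_precision p par (edge_weight \<delta> S) \<in> precision_class p e \<gamma>"
proof -
  let ?c = "edge_weight \<delta> S"
  let ?\<Omega> = "forest_precision p par ?c"
  have pc: "par i < i" if "?c i \<noteq> 0" for i using that par by (auto simp: edge_weight_def split: if_splits)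
  define r where "r = 1 - sqrt e"
  have se: "0 < sqrt e" "sqrt e < 1" using eps by auto
  then have r: "0 < r" "r \<le> 1" by (auto simp: r_def)
  have fin: "finite (spectrum ?\<Omega>)" by (rule card_finite_spectrum(1)[OF forest_precision_carrier])
  have ne: "spectrum ?\<Omega> \<noteq> {}" using one_in_forest_spectrum[OF free] by blast
  have bnd: "e \<le> l \<and> l \<le> inverse e" if "l \<in> spectrum ?\<Omega>" for l
  proof -
    have "(1 - r)\<^sup>2 \<le> l \<and> l \<le> (1 + r)\<^sup>2"
      by (rule forest_spectrum_bounds[OF par S r _ that]) (use small in \<open>auto simp: r_def\<close>)
    moreover have "(1 - r)\<^sup>2 = e" using eps by (simp add: r_def)
    moreover have "(1 + r)\<^sup>2 \<le> inverse e"
    proof -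
      have "0 \<le> (1 - sqrt e)\<^sup>2" by simp
      then have "(1 + r) * sqrt e \<le> 1" by (simp add: r_def power2_eq_square algebra_simps)
      then have "((1 + r) * sqrt e)\<^sup>2 \<le> 1" using r se by (simp add: power_le_one)
      then have "(1 + r)\<^sup>2 * e \<le> 1" using eps by (simp add: power_mult_distrib)
      then show ?thesis using eps by (simp add: field_simps)
    qed
    ultimately show ?thesis by linarith
  qed
  have "lambda_min ?\<Omega> \<in> spectrum ?\<Omega>" "lambda_max ?\<Omega> \<in> spectrum ?\<Omega>"
    unfolding lambda_min_def lambda_max_def using fin ne by auto
  moreover have "lambda_min ?\<Omega> \<le> lambda_max ?\<Omega>"
    unfolding lambda_min_def lambda_max_def using fin ne by (meson Max_ge Min_in)
  moreover have "pos_def p ?\<Omega>" using pc by (intro pos_def_forest_precision) auto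
  moreover have "is_mcd p ?\<Omega> (forest_mat p par ?c) (1\<^sub>m p)" using pc by (intro is_mcd_forest) auto
  moreover have "inf_norm_mat (forest_mat p par ?c - banding k (forest_mat p par ?c)) \<le> \<gamma> k"
    if "0 < k" for k
    using that free(1) \<gamma> d par tail by (intro inf_norm_forest_tail) auto
  ultimately show ?thesis unfolding precision_class_def using bnd by blast
qed

section \<open>Sampling laws of forest models\<close>

lemma normal_vec_density_forest:
  assumes par: "\<And>m. m \<in> S \<Longrightarrow> par m < m"
  shows "normal_vec_density p (inv_mat (forest_precision p par (edge_weight \<delta> S))) x = forest p par \<delta> S x"
proof -
  let ?c = "edge_weight \<delta> S"
  let ?\<Omega> = "forest_precision p par ?c"
  have pc: "par i < i" if "?c i \<noteq> 0" for i using that par by (auto simp: edge_weight_def split: if_splits)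
  have det: "Determinant.det ?\<Omega> = 1" using pc by (intro det_forest_precision) auto
  have "scalar_prod (Matrix.vec p x) (?\<Omega> *\<^sub>v Matrix.vec p x)
      = (\<Sum>i<p. (Matrix.vec p x $ i - ?c i * (if ?c i = 0 then 0 else Matrix.vec p x $ par i))\<^sup>2)"
    using pc by (intro forest_quadratic_form) auto
  also have "\<dots> = (\<Sum>i<p. (x i - ?c i * x (par i))\<^sup>2)"
  proof (intro sum.cong refl)
    fix i assume "i \<in> {..<p}"
    moreover have "par i < p" if "?c i \<noteq> 0" using pc[OF that] \<open>i \<in> {..<p}\<close> by simp
    ultimately show "(Matrix.vec p x $ i - ?c i * (if ?c i = 0 then 0 else Matrix.vec p x $ par i))\<^sup>2
        = (x i - ?c i * x (par i))\<^sup>2" by auto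
  qed
  finally have quad: "scalar_prod (Matrix.vec p x) (?\<Omega> *\<^sub>v Matrix.vec p x) = (\<Sum>i<p. (x i - ?c i * x (par i))\<^sup>2)" .
  have "forest p par \<delta> S x = (\<Prod>m<p. 1 / sqrt (2 * pi)) * (\<Prod>m<p. exp (- (x m - ?c m * x (par m))\<^sup>2 / 2))"
    unfolding forest_density_def normal_density_def prod.distrib[symmetric] by simp
  also have "(\<Prod>m<p. 1 / sqrt (2 * pi)) = 1 / sqrt ((2 * pi) ^ p)"
    by (simp add: power_divide real_sqrt_power[symmetric] power_mult_distrib)
  also have "(\<Prod>m<p. exp (- (x m - ?c m * x (par m))\<^sup>2 / 2)) = exp (- (\<Sum>i<p. (x i - ?c i * x (par i))\<^sup>2) / 2)"
    by (simp add: exp_sum[symmetric] sum_negf sum_divide_distrib)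
  finally show ?thesis
    unfolding normal_vec_density_def
    using det det_inv_mat[OF forest_precision_carrier det] inv_mat_inv_mat[OF forest_precision_carrier, of p par ?c]
    by (simp add: quad)
qed

lemma sample_law_forest:
  assumes S: "S \<subseteq> {..<p}" and par: "\<And>m. m \<in> S \<Longrightarrow> par m < m"
  shows "sample_law n p (forest_precision p par (edge_weight \<delta> S)) = forest_law n p par \<delta> S"
proof -
  have pc: "par i < i" if "edge_weight \<delta> S i \<noteq> 0" for i
    using that par by (auto simp: edge_weight_def split: if_splits)
  have [measurable]: "forest p par \<delta> S \<in> borel_measurable (lborel_vec p)"
    using pc by (intro measurable_forest_density) auto
  have nn: "forest p par \<delta> S x \<ge> 0" for x using forest_pos[of p par \<delta> S x] by simp
  have "(\<integral>\<^sup>+x. ennreal (forest p par \<delta> S x) \<partial>lborel_vec p) = 1"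
    using pc by (intro nn_integral_forest_density) auto
  then have "prob_space (density (lborel_vec p) (\<lambda>x. ennreal (forest p par \<delta> S x)))"
    by (intro prob_spaceI) (simp add: emeasure_density cong: nn_integral_cong)
  then have sf: "sigma_finite_measure (density (lborel_vec p) (\<lambda>x. ennreal (forest p par \<delta> S x)))"
    by (simp add: prob_space_imp_sigma_finite)
  have "sample_law n p (forest_precision p par (edge_weight \<delta> S))
      = Pi\<^sub>M {..<n} (\<lambda>_. density (lborel_vec p) (\<lambda>x. ennreal (forest p par \<delta> S x)))"
    unfolding sample_law_def normal_vec_measure_def
    using normal_vec_density_forest[OF par, where p = p and \<delta> = \<delta>] by simp
  also have "\<dots> = density (Pi\<^sub>M {..<n} (\<lambda>_. lborel_vec p)) (\<lambda>x. \<Prod>s<n. ennreal (forest p par \<delta> S (x s)))"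
    using sf sigma_finite_lborel_vec by (intro density_PiM_finite) auto
  also have "\<dots> = forest_law n p par \<delta> S"
    unfolding forest_law_def using nn by (simp add: prod_ennreal)
  finally show ?thesis .
qed

section \<open>Lower bounds for the spectral norm\<close>

lemma spectral_norm_ge_column:
  fixes M :: "real mat"
  assumes M: "M \<in> carrier_mat p p" and j: "j < p"
  shows "sqrt (\<Sum>i<p. (M $$ (i, j))\<^sup>2) \<le> spectral_norm M"
proof -
  let ?K = "\<Sum>i<p. (\<Sum>j<p. \<bar>M $$ (i, j)\<bar>)\<^sup>2"
  let ?X = "{l2_norm_vec (M *\<^sub>v v) | v. v \<in> carrier_vec (dim_col M) \<and> l2_norm_vec v \<le> 1}"
  have norm_Mv: "l2_norm_vec (M *\<^sub>v v) = sqrt (\<Sum>i<p. (\<Sum>j<p. M $$ (i, j) * v $ j)\<^sup>2)"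
    if "v \<in> carrier_vec p" for v
  proof -
    have "M *\<^sub>v v \<in> carrier_vec p" using M that by (rule mult_mat_vec_carrier)
    then show ?thesis
      using M that by (simp add: l2_norm_vec_def scalar_prod_def atLeast0LessThan power2_eq_square)
  qed
  \<comment> \<open>the supremum is only informative once the set is known to be bounded\<close>
  have "bdd_above ?X"
  proof (rule bdd_aboveI)
    fix y assume "y \<in> ?X"
    then obtain v where v: "v \<in> carrier_vec p" "l2_norm_vec v \<le> 1" and y: "y = l2_norm_vec (M *\<^sub>v v)"
      using M by auto
    have vj: "\<bar>v $ j\<bar> \<le> 1" if "j < p" for j
    proof -
      have "(v $ j)\<^sup>2 \<le> (\<Sum>j<p. (v $ j)\<^sup>2)" using that by (intro member_le_sum) auto
      also have "\<dots> \<le> 1" using v by (simp add: l2_norm_vec_def scalar_prod_self)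
      finally show ?thesis by (simp add: abs_square_le_1)
    qed
    have "(\<Sum>i<p. (\<Sum>j<p. M $$ (i, j) * v $ j)\<^sup>2) \<le> ?K"
    proof (rule sum_mono)
      fix i
      have "\<bar>\<Sum>j<p. M $$ (i, j) * v $ j\<bar> \<le> (\<Sum>j<p. \<bar>M $$ (i, j) * v $ j\<bar>)" by (rule sum_abs)
      also have "\<dots> \<le> (\<Sum>j<p. \<bar>M $$ (i, j)\<bar>)"
        using vj by (intro sum_mono) (simp add: abs_mult mult_left_le)
      finally have "\<bar>\<Sum>j<p. M $$ (i, j) * v $ j\<bar>\<^sup>2 \<le> (\<Sum>j<p. \<bar>M $$ (i, j)\<bar>)\<^sup>2"
        by (intro power_mono) auto
      then show "(\<Sum>j<p. M $$ (i, j) * v $ j)\<^sup>2 \<le> (\<Sum>j<p. \<bar>M $$ (i, j)\<bar>)\<^sup>2" by simp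
    qed
    then show "y \<le> sqrt ?K" unfolding y norm_Mv[OF v(1)] by (rule real_sqrt_le_mono)
  qed
  moreover have "l2_norm_vec (M *\<^sub>v unit_vec p j) \<in> ?X"
    using M j by (auto simp: l2_norm_vec_def intro!: exI[of _ "unit_vec p j"])
  ultimately have "l2_norm_vec (M *\<^sub>v unit_vec p j) \<le> spectral_norm M"
    unfolding spectral_norm_def by (intro cSup_upper)
  moreover have "(\<Sum>k<p. M $$ (i, k) * unit_vec p j $ k) = M $$ (i, j)" for i
  proof -
    have "(\<Sum>k<p. M $$ (i, k) * unit_vec p j $ k) = (\<Sum>k<p. if k = j then M $$ (i, k) else 0)"
      using j by (intro sum.cong refl) (auto simp: unit_vec_def)
    then show ?thesis using j by simp
  qed
  ultimately show ?thesis by (simp add: norm_Mv)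
qed

lemma spectral_norm_ge_entry:
  fixes M :: "real mat"
  assumes M: "M \<in> carrier_mat p p" and ij: "i < p" "j < p"
  shows "\<bar>M $$ (i, j)\<bar> \<le> spectral_norm M"
proof -
  have "\<bar>M $$ (i, j)\<bar> = sqrt ((M $$ (i, j))\<^sup>2)" by simp
  also have "\<dots> \<le> sqrt (\<Sum>i<p. (M $$ (i, j))\<^sup>2)"
    using ij by (intro real_sqrt_le_mono member_le_sum) auto
  finally show ?thesis using spectral_norm_ge_column[OF M ij(2)] by linarith
qed

text \<open>
  The loss through which the star is analysed: by Cauchy-Schwarz a column's Euclidean norm dominates,
  up to the factor \<open>sqrt (card K)\<close>, the sum of its absolute entries in \<open>K\<close>, and such a sum can be bounded below one coordinate at a time.
\<close>

lemma spectral_norm_ge_column_mean: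
  fixes M :: "real mat"
  assumes M: "M \<in> carrier_mat p p" and j: "j < p" and K: "K \<subseteq> {..<p}"
  shows "(\<Sum>i\<in>K. \<bar>M $$ (i, j)\<bar>) \<le> sqrt (card K) * spectral_norm M"
proof -
  have "(\<Sum>i\<in>K. \<bar>M $$ (i, j)\<bar>) = (\<Sum>i\<in>K. 1 * \<bar>M $$ (i, j)\<bar>)" by simp
  also have "\<dots> \<le> sqrt (card K) * sqrt (\<Sum>i\<in>K. (M $$ (i, j))\<^sup>2)"
    using L2_set_mult_ineq[of "\<lambda>_. 1" "\<lambda>i. M $$ (i, j)" K] by (simp add: L2_set_def)
  also have "\<dots> \<le> sqrt (card K) * sqrt (\<Sum>i<p. (M $$ (i, j))\<^sup>2)"
    using K by (intro mult_left_mono real_sqrt_le_mono sum_mono2) auto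
  also have "\<dots> \<le> sqrt (card K) * spectral_norm M"
    by (intro mult_left_mono spectral_norm_ge_column[OF M j]) auto
  finally show ?thesis .
qed

section \<open>The two minimax lower bounds\<close>

text \<open>
  If \<open>i\<close> is a leaf, column \<open>i\<close> of \<open>1 - A\<close> is a unit vector, so the Gram matrix has the same row \<open>i\<close> as
  \<open>1 - A\<close>. The edge weight can therefore be read off \<open>\<Omega>\<close> directly.
\<close>

lemma forest_precision_leaf_entry:
  assumes i: "i < p" "par i < i" "i \<notin> par ` S"
  shows "forest_precision p par (edge_weight \<delta> S) $$ (i, par i) = - edge_weight \<delta> S i"
proof -
  let ?B = "1\<^sub>m p - forest_mat p par (edge_weight \<delta> S)"
  have B: "?B \<in> carrier_mat p p" by (rule forest_factor_carrier)
  have ent: "?B $$ (l, j) = (if l = j then 1 else 0) - (if j = par l then edge_weight \<delta> S l else 0)"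
    if "l < p" "j < p" for l j using that by (simp add: forest_mat_def)
  have pi: "par i < p" using i by simp
  have gram: "(transpose_mat C * C) $$ (l, j) = (\<Sum>m<p. C $$ (m, l) * C $$ (m, j))"
    if "C \<in> carrier_mat p p" "l < p" "j < p" for C :: "real mat" and l j
    using that by (auto simp: scalar_prod_def atLeast0LessThan)
  have "forest_precision p par (edge_weight \<delta> S) $$ (i, par i) = (\<Sum>l<p. ?B $$ (l, i) * ?B $$ (l, par i))"
    unfolding forest_precision_def by (rule gram[OF B i(1) pi])
  also have "\<dots> = (\<Sum>l<p. if l = i then ?B $$ (l, par i) else 0)"
    using i by (intro sum.cong refl) (auto simp: ent pi edge_weight_def)
  also have "\<dots> = - edge_weight \<delta> S i" using i pi by (simp add: ent)
  finally show ?thesis .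
qed

lemma measurable_estimator_entry:
  assumes "T \<in> estimators n p" "i < p" "j < p"
  shows "(\<lambda>x. T x $$ (i, j)) \<in> borel_measurable (Pi\<^sub>M {..<n} (\<lambda>_::nat. lborel_vec p))"
proof -
  have "sets (sample_space n p) = sets (Pi\<^sub>M {..<n} (\<lambda>_::nat. lborel_vec p))"
    unfolding sample_space_def by (intro sets_PiM_cong) auto
  then show ?thesis using assms measurable_cong_sets[OF _ refl] unfolding estimators_def by blast
qed

text \<open>
  The spectral norm loss is bounded below by a function \<open>f\<close> of a few entries, so that its own
  measurability never has to be discussed.
\<close>

lemma risk_lower:
  assumes T: "T \<in> estimators n p" and S: "S \<subseteq> {..<p}" and par: "\<And>m. m \<in> S \<Longrightarrow> par m < m"
    and f: "\<And>M. M \<in> carrier_mat p p \<Longrightarrow> f M \<le> spectral_norm M"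
  shows "(\<integral>\<^sup>+x. ennreal (f (T x - forest_precision p par (edge_weight \<delta> S))) \<partial>forest_law n p par \<delta> S)
    \<le> risk n p T (forest_precision p par (edge_weight \<delta> S))"
proof -
  have "sample_law n p (forest_precision p par (edge_weight \<delta> S)) = forest_law n p par \<delta> S"
    using S par by (intro sample_law_forest) auto
  then show ?thesis unfolding risk_def
  proof (simp only:, intro nn_integral_mono ennreal_leI f)
    fix x assume "x \<in> space (forest_law n p par \<delta> S)"
    moreover have "space (forest_law n p par \<delta> S) = space (sample_space n p)"
      by (simp add: forest_law_def sample_space_def space_PiM)
    ultimately have "T x \<in> carrier_mat p p" using T unfolding estimators_def by blast
    then show "T x - forest_precision p par (edge_weight \<delta> S) \<in> carrier_mat p p"
      by (intro minus_carrier_mat) simp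
  qed
qed

text \<open>
  The empty forest against the \<open>p - 1\<close> forests with the single edge from \<open>i\<close> to \<open>i - 1\<close>.
  Their \<open>A\<close> have bandwidth 1, so the bound holds for every nonnegative \<open>\<gamma>\<close>.
\<close>

lemma minimax_risk_ge_single_edge:
  assumes p: "p \<ge> 3" and eps: "0 < e" "e < 1" and \<gamma>: "\<And>k. k > 0 \<Longrightarrow> \<gamma> k \<ge> 0"
    and a: "0 < a" "a \<le> 1/2" "a \<le> 1 - sqrt e" and few: "exp (2 * real n * a\<^sup>2) \<le> real p"
  shows "ennreal (a / 4) \<le> minimax_risk n p e \<gamma>"
  unfolding minimax_risk_def
proof (rule INF_greatest)
  fix T assume T: "T \<in> estimators n p"
  define par :: "nat \<Rightarrow> nat" where "par i = i - 1" for i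
  define I where "I = {1..<p}"
  define \<Omega> where "\<Omega> S = forest_precision p par (edge_weight a S)" for S
  let ?R = "SUP \<Omega> \<in> precision_class p e \<gamma>. risk n p T \<Omega>"
  let ?X = "Pi\<^sub>M {..<n} (\<lambda>_::nat. lborel_vec p)"
  let ?t = "\<lambda>i x. T x $$ (i, par i)"
  have I: "finite I" "I \<noteq> {}" "I \<subseteq> {..<p}" and card: "real (card I) = real p - 1"
    using p by (auto simp: I_def of_nat_diff)
  have par: "par i < i" if "i \<in> I" for i using that by (auto simp: I_def par_def)
  have cls: "risk n p T (\<Omega> S) \<le> ?R" if S: "S = {} \<or> (\<exists>i\<in>I. S = {i})" for S
  proof (rule SUP_upper, unfold \<Omega>_def)
    have "\<exists>m<p. m \<notin> S \<and> m \<notin> par ` S"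
    proof (cases "S \<subseteq> {1}")
      case True
      then show ?thesis using p by (intro exI[of _ 2]) (auto simp: par_def)
    next
      case False
      with S obtain i where i: "S = {i}" "i \<noteq> 1" "i \<in> I" by auto
      then show ?thesis using p by (intro exI[of _ 0]) (auto simp: par_def I_def)
    qed
    then obtain m where m: "m < p" "m \<notin> S" "m \<notin> par ` S" by blast
    have c1: "card S \<le> 1" using S by auto
    have "real (card S) * a\<^sup>2 \<le> 1 * a\<^sup>2" using c1 by (intro mult_right_mono) auto
    also have "\<dots> \<le> (1 - sqrt e)\<^sup>2" using a by (simp add: power_mono)
    finally have small: "real (card S) * a\<^sup>2 \<le> (1 - sqrt e)\<^sup>2" .
    show "forest_precision p par (edge_weight a S) \<in> precision_class p e \<gamma>"
      by (rule forest_in_precision_class[where m = m])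
        (use eps S par I m a small \<gamma> in \<open>auto simp: par_def\<close>)
  qed
  have ent: "\<Omega> S $$ (i, par i) = - edge_weight a S i" if "i \<in> I" "S = {} \<or> S = {i}" for i S
    unfolding \<Omega>_def using that I par[OF that(1)] by (intro forest_precision_leaf_entry) auto
  have dim: "dim_row (\<Omega> S) = p" "dim_col (\<Omega> S) = p" for S
    using forest_precision_carrier[of p par] unfolding \<Omega>_def by blast+
  have lt: "i < p" "par i < p" if "i \<in> I" for i using that by (auto simp: I_def par_def)
  have meas [measurable]: "?t i \<in> borel_measurable ?X" if "i \<in> I" for i
    by (rule measurable_estimator_entry[OF T lt[OF that]])
  \<comment> \<open>the loss at the empty forest must be compared with all alternatives at once, hence the maximum\<close>
  define u where "u x = Max ((\<lambda>i. \<bar>?t i x\<bar>) ` I)" for x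
  have u: "\<bar>?t i x\<bar> \<le> u x" if "i \<in> I" for i x unfolding u_def using I that by auto
  have u0: "0 \<le> u x" for x using u I by (meson abs_ge_zero equals0I order_trans)
  have um: "u \<in> borel_measurable ?X"
    unfolding u_def[abs_def] using I by (intro borel_measurable_Max) auto
  have detect: "ennreal (a * real (card I) / 2)
    \<le> ennreal (real (card I)) * (\<integral>\<^sup>+x. ennreal (u x) \<partial>forest_law n p par a {})
       + (\<Sum>i\<in>I. \<integral>\<^sup>+x. ennreal \<bar>?t i x + a\<bar> \<partial>forest_law n p par a (insert i {}))"
  proof (rule forest_edge_detection)
    show "exp (2 * real n * a\<^sup>2) \<le> real (card I) + 1" using few card by simp
    show "a \<le> u x + \<bar>?t i x + a\<bar>" if "i \<in> I" for i x using u[OF that, of x] by linarith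
  qed (use I par a um u0 in auto)
  have null: "(\<integral>\<^sup>+x. ennreal (u x) \<partial>forest_law n p par a {}) \<le> ?R"
  proof -
    let ?f = "\<lambda>M. Max ((\<lambda>i. \<bar>M $$ (i, par i)\<bar>) ` I)"
    have "u x = ?f (T x - \<Omega> {})" for x
      unfolding u_def using lt by (intro arg_cong[where f = Max] image_cong refl) (simp add: dim ent edge_weight_def)
    then have "(\<integral>\<^sup>+x. ennreal (u x) \<partial>forest_law n p par a {}) \<le> risk n p T (\<Omega> {})"
      unfolding \<Omega>_def using risk_lower[OF T, of "{}" par ?f a] I lt
      by (auto intro!: spectral_norm_ge_entry)
    also have "\<dots> \<le> ?R" by (rule cls) simp
    finally show ?thesis .
  qed
  have alt: "(\<Sum>i\<in>I. \<integral>\<^sup>+x. ennreal \<bar>?t i x + a\<bar> \<partial>forest_law n p par a (insert i {})) \<le> (\<Sum>i\<in>I. ?R)"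
  proof (rule sum_mono)
    fix i assume i: "i \<in> I"
    have "\<bar>?t i x + a\<bar> = \<bar>(T x - \<Omega> {i}) $$ (i, par i)\<bar>" for x
      using lt[OF i] i by (simp add: dim ent edge_weight_def)
    then have "(\<integral>\<^sup>+x. ennreal \<bar>?t i x + a\<bar> \<partial>forest_law n p par a {i})
        = (\<integral>\<^sup>+x. ennreal \<bar>(T x - \<Omega> {i}) $$ (i, par i)\<bar> \<partial>forest_law n p par a {i})" by simp
    also have "\<dots> \<le> risk n p T (\<Omega> {i})"
      unfolding \<Omega>_def using par[OF i] lt[OF i]
      by (intro risk_lower[OF T, where f = "\<lambda>M. \<bar>M $$ (i, par i)\<bar>"] spectral_norm_ge_entry[of _ p]) auto
    also have "\<dots> \<le> ?R" using i by (intro cls) auto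
    finally show "(\<integral>\<^sup>+x. ennreal \<bar>?t i x + a\<bar> \<partial>forest_law n p par a (insert i {})) \<le> ?R" .
  qed
  have "ennreal (a * real (card I) / 2) \<le> ennreal (real (card I)) * ?R + (\<Sum>i\<in>I. ?R)"
    by (rule order_trans[OF detect]) (intro add_mono mult_left_mono null alt, simp)
  also have "\<dots> = ennreal (2 * real (card I)) * ?R"
  proof -
    have "ennreal (2 * real (card I)) = ennreal (real (card I)) + ennreal (real (card I))"
      by (subst ennreal_plus[symmetric]) auto
    moreover have "(\<Sum>i\<in>I. ?R) = ennreal (real (card I)) * ?R"
      by (simp add: ennreal_of_nat_eq_real_of_nat)
    ultimately show ?thesis by (simp only: distrib_right)
  qed
  also have "ennreal (a * real (card I) / 2) = ennreal (2 * real (card I)) * ennreal (a / 4)"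
    using a by (subst ennreal_mult[symmetric]) auto
  finally show "ennreal (a / 4) \<le> ?R"
    using I by (subst (asm) ennreal_mult_le_mult_iff) auto
qed

text \<open>
  Assouad's lemma for the stars whose edges join a subset of \<open>{1..k}\<close> to the root 0, that is, for \<open>2 ^ k\<close> fillings
  of the first column of \<open>A\<close>. Every coordinate of the column costs of order \<open>\<delta>\<close> on average over the subsets,
  since adding or removing one edge is undetectable; the \<open>k\<close> coordinates together cost
  \<open>k * \<delta> / sqrt k\<close>. The requirement \<open>k + 2 \<le> p\<close> leaves the last coordinate isolated.
\<close>

lemma minimax_risk_ge_star:
  assumes k: "k \<ge> 1" "k + 2 \<le> p" and eps: "0 < e" "e < 1" and \<gamma>: "\<And>k. k > 0 \<Longrightarrow> \<gamma> k \<ge> 0"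
    and d: "0 < \<delta>" "\<delta> \<le> 1/2" and few: "exp (2 * real n * \<delta>\<^sup>2) \<le> 2"
    and small: "real k * \<delta>\<^sup>2 \<le> (1 - sqrt e)\<^sup>2" and tail: "\<And>i. 0 < i \<Longrightarrow> i < k \<Longrightarrow> \<delta> \<le> \<gamma> i"
  shows "ennreal (sqrt (real k) * \<delta> / 4) \<le> minimax_risk n p e \<gamma>"
  unfolding minimax_risk_def
proof (rule INF_greatest)
  fix T assume T: "T \<in> estimators n p"
  define par :: "nat \<Rightarrow> nat" where "par i = 0" for i
  define K where "K = {1..k}"
  define \<Omega> where "\<Omega> S = forest_precision p par (edge_weight \<delta> S)" for S
  let ?R = "SUP \<Omega> \<in> precision_class p e \<gamma>. risk n p T \<Omega>"
  let ?X = "Pi\<^sub>M {..<n} (\<lambda>_::nat. lborel_vec p)"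
  define F where "F i S = (\<integral>\<^sup>+x. ennreal \<bar>T x $$ (i, 0) + edge_weight \<delta> S i\<bar> \<partial>forest_law n p par \<delta> S)" for i S
  have K: "finite K" "card K = k" "K \<subseteq> {..<p}" using k by (auto simp: K_def)
  have par: "par i < i" if "i \<in> K" for i using that by (auto simp: K_def par_def)
  have cls: "risk n p T (\<Omega> S) \<le> ?R" if S: "S \<subseteq> K" for S
  proof (rule SUP_upper, unfold \<Omega>_def)
    have "real (card S) * \<delta>\<^sup>2 \<le> real k * \<delta>\<^sup>2"
      using card_mono[OF K(1) S] K by (intro mult_right_mono) auto
    then have sm: "real (card S) * \<delta>\<^sup>2 \<le> (1 - sqrt e)\<^sup>2" using small by linarith
    show "forest_precision p par (edge_weight \<delta> S) \<in> precision_class p e \<gamma>"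
    proof (rule forest_in_precision_class[where m = "p - 1"])
      show "\<delta> \<le> \<gamma> j" if "j > 0" "i \<in> S" "j < i - par i" for j i
        using that S tail[of j] by (auto simp: K_def par_def)
      show "p - 1 \<notin> S" using subsetD[OF S, of "p - 1"] k by (auto simp: K_def)
    qed (use eps S par K k d sm \<gamma> in \<open>auto simp: par_def K_def\<close>)
  qed
  have ent: "\<Omega> S $$ (i, 0) = - edge_weight \<delta> S i" if "i \<in> K" "S \<subseteq> K" for i S
    unfolding \<Omega>_def using forest_precision_leaf_entry[of i p par S \<delta>] that K par[OF that(1)]
    by (auto simp: par_def)
  have dim: "dim_row (\<Omega> S) = p" "dim_col (\<Omega> S) = p" for S
    using forest_precision_carrier[of p par] unfolding \<Omega>_def by blast+
  have lt: "i < p" "0 < p" if "i \<in> K" for i using that k by (auto simp: K_def)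
  have meas [measurable]: "(\<lambda>x. T x $$ (i, 0)) \<in> borel_measurable ?X" if "i \<in> K" for i
    by (rule measurable_estimator_entry[OF T lt[OF that]])
  have column: "ennreal (1 / sqrt (real k)) * (\<Sum>i\<in>K. F i S) \<le> ?R" if S: "S \<subseteq> K" for S
  proof -
    let ?L = "forest_law n p par \<delta> S"
    have sets_L: "sets ?L = sets ?X" by (simp add: forest_law_def)
    have ml: "(\<lambda>x. ennreal \<bar>T x $$ (i, 0) + edge_weight \<delta> S i\<bar>) \<in> borel_measurable ?L" if "i \<in> K" for i
      using meas[OF that] unfolding measurable_cong_sets[OF sets_L refl] by measurable
    let ?f = "\<lambda>M. 1 / sqrt (real k) * (\<Sum>i\<in>K. \<bar>M $$ (i, 0)\<bar>)"
    have "ennreal (1 / sqrt (real k)) * (\<Sum>i\<in>K. F i S)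
        = (\<integral>\<^sup>+x. ennreal (1 / sqrt (real k)) * (\<Sum>i\<in>K. ennreal \<bar>T x $$ (i, 0) + edge_weight \<delta> S i\<bar>) \<partial>?L)"
      unfolding F_def using ml
      by (simp add: nn_integral_cmult nn_integral_sum del: sum_ennreal)
    also have "\<dots> = (\<integral>\<^sup>+x. ennreal (?f (T x - \<Omega> S)) \<partial>?L)"
    proof (rule nn_integral_cong)
      fix x
      have "(\<Sum>i\<in>K. \<bar>(T x - \<Omega> S) $$ (i, 0)\<bar>) = (\<Sum>i\<in>K. \<bar>T x $$ (i, 0) + edge_weight \<delta> S i\<bar>)"
        using lt S by (intro sum.cong refl) (simp add: dim ent)
      then show "ennreal (1 / sqrt (real k)) * (\<Sum>i\<in>K. ennreal \<bar>T x $$ (i, 0) + edge_weight \<delta> S i\<bar>)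
          = ennreal (?f (T x - \<Omega> S))"
        by (subst sum_ennreal, simp, subst ennreal_mult[symmetric]) (auto simp: sum_nonneg)
    qed
    also have "\<dots> \<le> risk n p T (\<Omega> S)"
      unfolding \<Omega>_def
    proof (rule risk_lower[OF T])
      fix M :: "real mat" assume M: "M \<in> carrier_mat p p"
      have "(\<Sum>i\<in>K. \<bar>M $$ (i, 0)\<bar>) \<le> sqrt (real k) * spectral_norm M"
        using spectral_norm_ge_column_mean[OF M _ K(3), of 0] k K by simp
      then show "?f M \<le> spectral_norm M" using k by (simp add: field_simps)
    qed (use S K par in auto)
    also have "\<dots> \<le> ?R" by (rule cls[OF S])
    finally show ?thesis .
  qed
  have pair: "ennreal (\<delta> / 2) \<le> F i S + F i (insert i S)" if i: "i \<in> K" and S: "S \<subseteq> K - {i}" for i S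
  proof -
    have "ennreal (\<delta> * real (card {i}) / 2)
      \<le> ennreal (real (card {i})) * (\<integral>\<^sup>+x. ennreal \<bar>T x $$ (i, 0)\<bar> \<partial>forest_law n p par \<delta> S)
       + (\<Sum>j\<in>{i}. \<integral>\<^sup>+x. ennreal \<bar>T x $$ (i, 0) + \<delta>\<bar> \<partial>forest_law n p par \<delta> (insert j S))"
    proof (rule forest_edge_detection)
      show "par m < m" if "m \<in> {i} \<union> S" for m using that i S par by auto
      show "par j \<notin> S" if "j \<in> {i}" for j using S by (auto simp: par_def K_def)
    qed (use i S K d few meas in auto)
    then show ?thesis using S by (auto simp: F_def edge_weight_def)
  qed
  have coord: "ennreal (2 ^ k * (\<delta> / 4)) \<le> (\<Sum>S\<in>Pow K. F i S)" if i: "i \<in> K" for i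
  proof -
    let ?P = "Pow (K - {i})"
    have fin: "finite ?P" using K by simp
    have "card ?P = 2 ^ (k - 1)" using K i by (simp add: card_Pow)
    moreover have "(2::real) ^ k = 2 * 2 ^ (k - 1)" using k by (cases k) auto
    ultimately have "ennreal (2 ^ k * (\<delta> / 4)) = (\<Sum>S\<in>?P. ennreal (\<delta> / 2))"
      using d by (simp add: ennreal_of_nat_eq_real_of_nat ennreal_mult'[symmetric])
    also have "\<dots> \<le> (\<Sum>S\<in>?P. F i S + F i (insert i S))"
      using pair[OF i] by (intro sum_mono) auto
    also have "\<dots> = (\<Sum>S\<in>?P. F i S) + (\<Sum>S\<in>insert i ` ?P. F i S)"
    proof -
      have "inj_on (insert i) ?P"
      proof (rule inj_onI)
        fix A B assume "A \<in> ?P" "B \<in> ?P" and eq: "insert i A = insert i B"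
        then have "i \<notin> A" "i \<notin> B" by auto
        then show "A = B" using eq insert_ident[of i A B] by simp
      qed
      then show ?thesis by (simp add: sum.distrib sum.reindex)
    qed
    also have "\<dots> = (\<Sum>S\<in>?P \<union> insert i ` ?P. F i S)"
      using fin by (intro sum.union_disjoint[symmetric]) auto
    also have "?P \<union> insert i ` ?P = Pow K"
      using i Pow_insert[of i "K - {i}"] by (simp add: insert_absorb)
    finally show ?thesis .
  qed
  have "ennreal (2 ^ k) * ennreal (sqrt (real k) * \<delta> / 4)
      = ennreal (1 / sqrt (real k)) * (\<Sum>i\<in>K. ennreal (2 ^ k * (\<delta> / 4)))"
  proof -
    have "real k / sqrt (real k) = sqrt (real k)" by (rule real_div_sqrt) simp
    moreover have "2 ^ k * (y / s * \<delta> / 4) = 1 / s * (y * (2 ^ k * (\<delta> / 4)))" for y s by simp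
    ultimately have "2 ^ k * (sqrt (real k) * \<delta> / 4) = 1 / sqrt (real k) * (real k * (2 ^ k * (\<delta> / 4)))"
      by metis
    moreover have "(\<Sum>i\<in>K. ennreal (2 ^ k * (\<delta> / 4))) = ennreal (real k * (2 ^ k * (\<delta> / 4)))"
      using d K by (subst sum_ennreal) auto
    ultimately show ?thesis using d by (simp add: ennreal_mult[symmetric])
  qed
  also have "\<dots> \<le> ennreal (1 / sqrt (real k)) * (\<Sum>i\<in>K. \<Sum>S\<in>Pow K. F i S)"
    by (intro mult_left_mono sum_mono coord) auto
  also have "\<dots> = (\<Sum>S\<in>Pow K. ennreal (1 / sqrt (real k)) * (\<Sum>i\<in>K. F i S))"
    by (subst sum.swap) (simp add: sum_distrib_left)
  also have "\<dots> \<le> (\<Sum>S\<in>Pow K. ?R)" using column by (intro sum_mono) auto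
  also have "\<dots> = ennreal (2 ^ k) * ?R"
    using K by (simp add: card_Pow ennreal_of_nat_eq_real_of_nat)
  finally show "ennreal (sqrt (real k) * \<delta> / 4) \<le> ?R"
    by (subst (asm) ennreal_mult_le_mult_iff) auto
qed

section \<open>Rates\<close>

text \<open>
  The weight \<open>a\<close> is a multiple of \<open>sqrt (ln p / n)\<close>; the growth condition on \<open>p\<close> keeps it bounded, and
  the factor \<open>1 / sqrt (1 + c)\<close> makes it small enough for \<open>minimax_risk_ge_single_edge\<close>.
\<close>

lemma minimax_risk_ge_sparse_rate:
  assumes eps: "0 < e" "e < 1" and \<gamma>: "\<And>k. k > 0 \<Longrightarrow> \<gamma> k \<ge> 0" and c: "c > 0"
    and p: "p \<ge> 3" and n: "n \<ge> 1" and bound: "real p \<le> exp (c * real n)"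
  shows "ennreal (min (1/2) (1 - sqrt e) / sqrt (1 + c) / 4 * sqrt (ln (real p) / real n))
    \<le> minimax_risk n p e \<gamma>"
proof -
  define r where "r = min (1/2) (1 - sqrt e)"
  define a where "a = r / sqrt (1 + c) * sqrt (ln (real p) / real n)"
  have r: "0 < r" "r \<le> 1/2" "r \<le> 1 - sqrt e" using eps by (auto simp: r_def min_def)
  have lp: "ln (real p) > 0" using p by simp
  have sc: "sqrt (1 + c) > 0" using c by simp
  have "ln (real p) \<le> ln (exp (c * real n))" using bound p by (subst ln_le_cancel_iff) auto
  then have "ln (real p) \<le> c * real n" by simp
  then have "ln (real p) / real n \<le> 1 + c" using n by (simp add: field_simps)
  then have "sqrt (ln (real p) / real n) / sqrt (1 + c) \<le> 1" using sc by simp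
  then have "r * (sqrt (ln (real p) / real n) / sqrt (1 + c)) \<le> r * 1"
    using r by (intro mult_left_mono) auto
  then have a: "a \<le> r" by (simp add: a_def)
  have a0: "a > 0" using r sc lp n by (simp add: a_def)
  have "a\<^sup>2 = r\<^sup>2 / (1 + c) * (ln (real p) / real n)"
    using c lp n by (simp add: a_def power_mult_distrib power_divide)
  then have "2 * real n * a\<^sup>2 = 2 * (r\<^sup>2 / (1 + c)) * ln (real p)" using n by simp
  also have "\<dots> \<le> 1 * ln (real p)"
  proof (rule mult_right_mono)
    have "r\<^sup>2 \<le> (1/2)\<^sup>2" using r by (intro power_mono) auto
    then show "2 * (r\<^sup>2 / (1 + c)) \<le> 1" using c by (simp add: power2_eq_square field_simps)
  qed (use lp in auto)
  finally have "exp (2 * real n * a\<^sup>2) \<le> exp (ln (real p))" by simp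
  then have "exp (2 * real n * a\<^sup>2) \<le> real p" using p by simp
  then have "ennreal (a / 4) \<le> minimax_risk n p e \<gamma>"
    using r a a0 by (intro minimax_risk_ge_single_edge p eps \<gamma>) auto
  then show ?thesis by (simp add: a_def r_def mult_ac)
qed

text \<open>
  The star with weight \<open>\<tau> / sqrt n\<close> and \<open>k\<close> edges, where \<open>k\<close> is \<open>\<lfloor>x\<rfloor>\<close> or, if that is smaller,
  \<open>p - 2\<close>. Both are at least a quarter of the real numbers \<open>x\<close> and \<open>p\<close> that they stand for.
\<close>

lemma minimax_risk_ge_star_rate:
  assumes eps: "0 < e" "e < 1" and \<gamma>: "\<And>k. k > 0 \<Longrightarrow> \<gamma> k \<ge> 0"
    and \<tau>: "0 < \<tau>" "\<tau> \<le> 1/2" "\<tau> \<le> 1 - sqrt e"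
    and p: "p \<ge> 3" and x: "1 \<le> x" "x \<le> real n"
    and tail: "\<And>i. 0 < i \<Longrightarrow> real i \<le> x \<Longrightarrow> \<tau> / sqrt (real n) \<le> \<gamma> i"
  shows "ennreal (\<tau> / 8 * min (sqrt (x / real n)) (sqrt (real p / real n))) \<le> minimax_risk n p e \<gamma>"
proof -
  define k where "k = min (p - 2) (nat \<lfloor>x\<rfloor>)"
  define d where "d = \<tau> / sqrt (real n)"
  have n: "real n \<ge> 1" using x by simp
  have fx: "real (nat \<lfloor>x\<rfloor>) \<le> x" "real (nat \<lfloor>x\<rfloor>) \<ge> x / 2" "nat \<lfloor>x\<rfloor> \<ge> 1"
  proof -
    have "real (nat \<lfloor>x\<rfloor>) = of_int \<lfloor>x\<rfloor>" "\<lfloor>x\<rfloor> \<ge> 1" using x by (simp_all add: le_floor_iff)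
    then show "real (nat \<lfloor>x\<rfloor>) \<le> x" "real (nat \<lfloor>x\<rfloor>) \<ge> x / 2" "nat \<lfloor>x\<rfloor> \<ge> 1"
      using x floor_correct[of x] by linarith+
  qed
  have k: "k \<ge> 1" "k + 2 \<le> p" "real k \<le> x" using p fx by (auto simp: k_def)
  have km: "min x (real p) / 4 \<le> real k" using p fx by (auto simp: k_def min_def)
  have d2: "real n * d\<^sup>2 = \<tau>\<^sup>2" using n by (simp add: d_def power_divide)
  have t2: "\<tau>\<^sup>2 \<le> (1 - sqrt e)\<^sup>2" "\<tau>\<^sup>2 \<le> (1/2)\<^sup>2" using \<tau> by (auto intro!: power_mono simp del: power_divide)
  have "ennreal (sqrt (real k) * d / 4) \<le> minimax_risk n p e \<gamma>"
  proof (rule minimax_risk_ge_star[OF k(1,2) eps \<gamma>])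
    show "0 < d" using \<tau> n by (simp add: d_def)
    have "sqrt (real n) \<ge> 1" using n by simp
    then have "d \<le> \<tau>" using \<tau> by (simp add: d_def divide_le_eq)
    then show "d \<le> 1/2" using \<tau> by simp
    have "2 * real n * d\<^sup>2 \<le> 1/2" using d2 t2(2) by (simp add: power2_eq_square mult.assoc)
    then have "exp (2 * real n * d\<^sup>2) \<le> exp (1/2)" by simp
    also have "\<dots> \<le> 2" by (rule exp_half_le2)
    finally show "exp (2 * real n * d\<^sup>2) \<le> 2" .
    have "real k * d\<^sup>2 \<le> real n * d\<^sup>2" using k x by (intro mult_right_mono) auto
    then show "real k * d\<^sup>2 \<le> (1 - sqrt e)\<^sup>2" using d2 t2 by simp
    show "d \<le> \<gamma> i" if "0 < i" "i < k" for i
      unfolding d_def using that k by (intro tail) auto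
  qed
  moreover have "\<tau> / 8 * min (sqrt (x / real n)) (sqrt (real p / real n)) \<le> sqrt (real k) * d / 4"
  proof -
    have "min (sqrt (x / real n)) (sqrt (real p / real n)) = sqrt (min x (real p)) / sqrt (real n)"
      using n by (auto simp: min_def real_sqrt_divide divide_le_cancel)
    also have "sqrt (min x (real p)) = 2 * sqrt (min x (real p) / 4)"
      by (simp add: real_sqrt_divide)
    also have "2 * sqrt (min x (real p) / 4) / sqrt (real n) \<le> 2 * sqrt (real k) / sqrt (real n)"
      using km n by (intro divide_right_mono mult_left_mono real_sqrt_le_mono) auto
    finally have "\<tau> / 8 * min (sqrt (x / real n)) (sqrt (real p / real n))
        \<le> \<tau> / 8 * (2 * sqrt (real k) / sqrt (real n))"
      using \<tau> by (intro mult_left_mono) auto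
    also have "\<dots> = sqrt (real k) * d / 4" by (simp add: d_def mult_ac)
    finally show ?thesis .
  qed
  ultimately show ?thesis by (meson ennreal_leI order_trans)
qed

lemma asymp_gtrsimI:
  assumes "K > 0" and "eventually (\<lambda>n. ennreal (K * a n) \<le> b n) sequentially"
  shows "b \<greatersim> a"
  unfolding asymp_gtrsim_def
proof (intro exI conjI)
  show "1 / K > 0" using assms by simp
  show "\<forall>\<^sub>F n in sequentially. ennreal (a n) \<le> ennreal (1 / K) * b n"
    using assms(2)
  proof eventually_elim
    case (elim n)
    have "ennreal (a n) = ennreal (1 / K) * ennreal (K * a n)"
      using assms(1) by (subst ennreal_mult'[symmetric]) auto
    also have "\<dots> \<le> ennreal (1 / K) * b n" using elim by (intro mult_left_mono) auto
    finally show ?case .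
  qed
qed

theorem theorem3p1:
  fixes p :: "nat \<Rightarrow> nat" and c \<epsilon>\<^sub>0 :: real and \<gamma> :: "nat \<Rightarrow> real"
  assumes p_infinity: "filterlim p at_top sequentially"
    and c_pos: "c > 0"
    and p_bound: "\<forall>n\<ge>1. real (p n) \<le> exp (c * real n)"
    and eps: "0 < \<epsilon>\<^sub>0" "\<epsilon>\<^sub>0 < 1"
    and gamma_decreasing: "antimono_on {1..} \<gamma>"
    and gamma_limit: "\<gamma> \<longlonglongrightarrow> 0"
  shows
    "((\<exists>k\<^sub>0::nat. k\<^sub>0 > 0 \<and> (\<forall>k\<ge>k\<^sub>0. \<gamma> k = 0)) \<longrightarrow>
       (\<lambda>n. minimax_risk n (p n) \<epsilon>\<^sub>0 \<gamma>) \<greatersim> (\<lambda>n. sqrt (ln (real (p n)) / real n)))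
     \<and>
     (\<forall>\<beta> C::real. \<beta> > 0 \<and> C > 0 \<and> (\<forall>k\<ge>1. \<gamma> k = C * exp (- \<beta> * real k)) \<longrightarrow>
       (\<lambda>n. minimax_risk n (p n) \<epsilon>\<^sub>0 \<gamma>) \<greatersim>
       (\<lambda>n. min (sqrt (ln (real (max n (p n))) / real n)) (sqrt (real (p n) / real n))))
     \<and>
     (\<forall>\<alpha> C::real. \<alpha> > 0 \<and> C > 0 \<and> (\<forall>k\<ge>1. \<gamma> k = C * real k powr (- \<alpha>)) \<longrightarrow>
       (\<lambda>n. minimax_risk n (p n) \<epsilon>\<^sub>0 \<gamma>) \<greatersim>
       (\<lambda>n. min (sqrt (ln (real (p n)) / real n) + real n powr (- \<alpha> / (2 * \<alpha> + 1)))
                (sqrt (real (p n) / real n))))"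
proof -
  let ?R = "\<lambda>n. minimax_risk n (p n) \<epsilon>\<^sub>0 \<gamma>"
  define r where "r = min (1/2) (1 - sqrt \<epsilon>\<^sub>0)"
  define \<kappa> where "\<kappa> = r / sqrt (1 + c) / 4"
  have r: "0 < r" "r \<le> 1/2" "r \<le> 1 - sqrt \<epsilon>\<^sub>0" using eps by (auto simp: r_def min_def)
  have \<kappa>: "\<kappa> > 0" using r c_pos by (simp add: \<kappa>_def)
  have \<gamma>0: "\<gamma> k \<ge> 0" if "k > 0" for k
  proof (rule LIMSEQ_le_const2[OF gamma_limit])
    show "\<exists>N. \<forall>m\<ge>N. \<gamma> m \<le> \<gamma> k"
      using that gamma_decreasing by (intro exI[of _ k]) (auto simp: monotone_on_def)
  qed
  have large: "\<forall>\<^sub>F n in sequentially. p n \<ge> 3 \<and> n \<ge> 1"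
    using p_infinity by (intro eventually_conj eventually_ge_at_top) (simp add: filterlim_at_top)
  have sparse: "ennreal (\<kappa> * sqrt (ln (real (p n)) / real n)) \<le> ?R n" if "p n \<ge> 3" "n \<ge> 1" for n
    unfolding \<kappa>_def r_def
    using minimax_risk_ge_sparse_rate[OF eps \<gamma>0 c_pos that] p_bound that by simp
  have star: "ennreal (\<tau> / 8 * min (sqrt (x / real n)) (sqrt (real (p n) / real n))) \<le> ?R n"
    if "p n \<ge> 3" "1 \<le> x" "x \<le> real n" "0 < \<tau>" "\<tau> \<le> r"
      "\<And>i. 0 < i \<Longrightarrow> real i \<le> x \<Longrightarrow> \<tau> / sqrt (real n) \<le> \<gamma> i" for n x \<tau>
    using that r by (intro minimax_risk_ge_star_rate eps \<gamma>0) auto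
  have part1: "?R \<greatersim> (\<lambda>n. sqrt (ln (real (p n)) / real n))"
    using large by (intro asymp_gtrsimI[OF \<kappa>]) (auto elim!: eventually_mono intro!: sparse)
  have part2: "?R \<greatersim> (\<lambda>n. min (sqrt (ln (real (max n (p n))) / real n)) (sqrt (real (p n) / real n)))"
    if \<beta>: "\<beta> > 0" and C: "C > 0" and g: "\<forall>k\<ge>1. \<gamma> k = C * exp (- \<beta> * real k)" for \<beta> C :: real
  proof -
    \<comment> \<open>\<open>q\<close> makes \<open>exp (- \<beta> * x) \<ge> 1 / sqrt n\<close> at star size \<open>x = q * ln n\<close>, and \<open>x \<le> n\<close>\<close>
    define q where "q = min 1 (1 / (2 * \<beta>))"
    define \<tau> where "\<tau> = min r C"
    have q: "0 < q" "q \<le> 1" "\<beta> * q \<le> 1/2"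
      using \<beta> by (auto simp: q_def min_def field_simps)
    have \<tau>: "0 < \<tau>" "\<tau> \<le> r" "\<tau> \<le> C" using r C by (auto simp: \<tau>_def)
    define K where "K = min \<kappa> (\<tau> / 8 * sqrt q)"
    have K: "K > 0" using \<kappa> \<tau> q by (simp add: K_def)
    have "filterlim (\<lambda>n::nat. q * ln (real n)) at_top sequentially"
      using q(1) by (intro filterlim_tendsto_pos_mult_at_top[OF tendsto_const]
        filterlim_compose[OF ln_at_top filterlim_real_sequentially])
    then have "\<forall>\<^sub>F n::nat in sequentially. q * ln (real n) \<ge> 1" by (simp add: filterlim_at_top)
    with large have "\<forall>\<^sub>F n in sequentially.
      ennreal (K * min (sqrt (ln (real (max n (p n))) / real n)) (sqrt (real (p n) / real n))) \<le> ?R n"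
    proof eventually_elim
      case (elim n)
      then have n: "n \<ge> 1" "p n \<ge> 3" by auto
      let ?P = "sqrt (real (p n) / real n)"
      have lnn: "ln (real n) \<ge> 0" using n by simp
      show ?case
      proof (cases "n \<le> p n")
        case True
        then have "K * min (sqrt (ln (real (max n (p n))) / real n)) ?P
            \<le> \<kappa> * sqrt (ln (real (p n)) / real n)"
          using K n by (intro mult_mono) (auto simp: K_def max_def)
        then show ?thesis using sparse[OF n(2,1)] by (meson ennreal_leI order_trans)
      next
        case False
        let ?x = "q * ln (real n)" and ?L = "sqrt (ln (real n) / real n)"
        have "ennreal (\<tau> / 8 * min (sqrt (?x / real n)) ?P) \<le> ?R n"
        proof (rule star[OF n(2) elim(2) _ \<tau>(1,2)])
          have "?x \<le> 1 * ln (real n)" using q lnn by (intro mult_right_mono) auto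
          also have "\<dots> \<le> real n" using ln_le_minus_one[of "real n"] n by simp
          finally show "?x \<le> real n" .
          fix i :: nat assume i: "0 < i" "real i \<le> ?x"
          have "\<beta> * real i \<le> \<beta> * ?x" using i \<beta> by (intro mult_left_mono) auto
          also have "\<dots> \<le> 1/2 * ln (real n)"
            unfolding mult.assoc[symmetric] using q lnn by (intro mult_right_mono) auto
          finally have "exp (- (1/2 * ln (real n))) \<le> exp (- \<beta> * real i)" by simp
          moreover have "exp (- (1/2 * ln (real n))) = 1 / sqrt (real n)"
            using n by (simp add: exp_minus powr_half_sqrt[symmetric] powr_def inverse_eq_divide)
          ultimately have "1 / sqrt (real n) \<le> exp (- \<beta> * real i)" by (simp only:)
          then have "\<tau> * (1 / sqrt (real n)) \<le> C * exp (- \<beta> * real i)"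
            using \<tau> C by (intro mult_mono) auto
          then show "\<tau> / sqrt (real n) \<le> \<gamma> i" using g i by simp
        qed
        moreover have "K * min (sqrt (ln (real (max n (p n))) / real n)) ?P
            \<le> \<tau> / 8 * min (sqrt (?x / real n)) ?P"
        proof -
          have sq: "sqrt q \<le> 1" using q by simp
          have "K * min ?L ?P \<le> \<tau> / 8 * sqrt q * min ?L ?P"
            using lnn by (intro mult_right_mono) (auto simp: K_def)
          also have "\<dots> = \<tau> / 8 * (sqrt q * min ?L ?P)" by simp
          also have "\<dots> \<le> \<tau> / 8 * min (sqrt (?x / real n)) ?P"
          proof (intro mult_left_mono min.boundedI)
            have "sqrt q * min ?L ?P \<le> sqrt q * ?L" using q by (intro mult_left_mono) auto
            also have "\<dots> = sqrt (?x / real n)" by (simp add: real_sqrt_mult[symmetric])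
            finally show "sqrt q * min ?L ?P \<le> sqrt (?x / real n)" .
            have "sqrt q * min ?L ?P \<le> 1 * ?P" using q sq lnn by (intro mult_mono) auto
            then show "sqrt q * min ?L ?P \<le> ?P" by simp
          qed (use \<tau> in auto)
          finally show ?thesis using False by (simp add: max_def)
        qed
        ultimately show ?thesis by (meson ennreal_leI order_trans)
      qed
    qed
    then show ?thesis by (rule asymp_gtrsimI[OF K])
  qed
  have part3: "?R \<greatersim> (\<lambda>n. min (sqrt (ln (real (p n)) / real n) + real n powr (- \<alpha> / (2 * \<alpha> + 1)))
                (sqrt (real (p n) / real n)))"
    if \<alpha>: "\<alpha> > 0" and C: "C > 0" and g: "\<forall>k\<ge>1. \<gamma> k = C * real k powr (- \<alpha>)" for \<alpha> C :: real
  proof -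
    define \<tau> where "\<tau> = min r C"
    have \<tau>: "0 < \<tau>" "\<tau> \<le> r" "\<tau> \<le> C" using r C by (auto simp: \<tau>_def)
    define K where "K = min \<kappa> (\<tau> / 8) / 2"
    have K: "K > 0" "2 * K \<le> \<kappa>" "2 * K \<le> \<tau> / 8" using \<kappa> \<tau> by (auto simp: K_def)
    from large have "\<forall>\<^sub>F n in sequentially.
      ennreal (K * min (sqrt (ln (real (p n)) / real n) + real n powr (- \<alpha> / (2 * \<alpha> + 1)))
        (sqrt (real (p n) / real n))) \<le> ?R n"
    proof eventually_elim
      case (elim n)
      then have n: "n \<ge> 1" "p n \<ge> 3" by auto
      let ?P = "sqrt (real (p n) / real n)" and ?A = "sqrt (ln (real (p n)) / real n)"
      \<comment> \<open>star size \<open>?x\<close>: then \<open>sqrt (?x / n) = ?B\<close>, and \<open>?x powr (- \<alpha>) = ?B \<ge> 1 / sqrt n\<close>\<close>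
      let ?B = "real n powr (- \<alpha> / (2 * \<alpha> + 1))" and ?x = "real n powr (1 / (2 * \<alpha> + 1))"
      have A: "?A \<ge> 0" using n by simp
      have dense: "ennreal (\<tau> / 8 * min (sqrt (?x / real n)) ?P) \<le> ?R n"
      proof (rule star[OF n(2) _ _ \<tau>(1,2)])
        show "1 \<le> ?x" using n \<alpha> by (simp add: ge_one_powr_ge_zero)
        have "?x \<le> real n powr 1" using n \<alpha> by (intro powr_mono) auto
        then show "?x \<le> real n" using n by simp
        fix i :: nat assume i: "0 < i" "real i \<le> ?x"
        have "1 / sqrt (real n) = real n powr (- (1/2))"
          using n by (simp add: powr_minus powr_half_sqrt inverse_eq_divide)
        also have "\<dots> \<le> real n powr (1 / (2 * \<alpha> + 1) * (- \<alpha>))"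
          using n \<alpha> by (intro powr_mono) (auto simp: field_simps)
        also have "\<dots> = ?x powr (- \<alpha>)" by (simp only: powr_powr)
        also have "\<dots> \<le> real i powr (- \<alpha>)" using i \<alpha> by (intro powr_mono2') auto
        finally have "\<tau> * (1 / sqrt (real n)) \<le> C * real i powr (- \<alpha>)"
          using \<tau> C by (intro mult_mono) auto
        then show "\<tau> / sqrt (real n) \<le> \<gamma> i" using g i by simp
      qed
      have "sqrt (?x / real n) = ?B"
      proof -
        have "?x / real n = real n powr (1 / (2 * \<alpha> + 1) - 1)" using n by (simp add: powr_diff)
        then have "sqrt (?x / real n) = (real n powr (1 / (2 * \<alpha> + 1) - 1)) powr (1/2)"
          by (simp add: powr_half_sqrt)
        also have "\<dots> = real n powr ((1 / (2 * \<alpha> + 1) - 1) * (1/2))" by (simp only: powr_powr)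
        also have "(1 / (2 * \<alpha> + 1) - 1) * (1/2) = - \<alpha> / (2 * \<alpha> + 1)"
          using \<alpha> by (simp add: field_simps)
        finally show ?thesis .
      qed
      then have dense': "ennreal (\<tau> / 8 * min ?B ?P) \<le> ?R n" using dense by simp
      have mB: "0 \<le> min ?B ?P" by simp
      have split_min: "min (y + b) q \<le> y + min b q" if "0 \<le> y" for y b q :: real
        using that by (simp add: min_def)
      have "K * min (?A + ?B) ?P \<le> K * (?A + min ?B ?P)"
        using K A by (intro mult_left_mono split_min) auto
      also have "\<dots> \<le> max (2 * K * ?A) (2 * K * min ?B ?P)" by (simp add: algebra_simps max_def)
      also have "\<dots> \<le> max (\<kappa> * ?A) (\<tau> / 8 * min ?B ?P)"
        using K A mB by (intro max.mono mult_right_mono) auto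
      finally have "ennreal (K * min (?A + ?B) ?P) \<le> ennreal (max (\<kappa> * ?A) (\<tau> / 8 * min ?B ?P))"
        by (rule ennreal_leI)
      also have "\<dots> \<le> ?R n"
        using sparse[OF n(2,1)] dense' by (simp add: max_def)
      finally show ?case .
    qed
    then show ?thesis by (rule asymp_gtrsimI[OF K(1)])
  qed
  show ?thesis using part1 part2 part3 by blast
qed

end
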